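(* Let $n\geq 1$, let $W=\mathfrak{S}_n$ with $S=\{s_1,\dots,s_{n-1}\}$, $s_i=(i,i+1)$, and let $\ast=\mathrm{id}$. Let $M$ be the $\mathcal{H}_u$-module described in the context and $X_{\emptyset}=\sum_{x\in\mathfrak{S}_n}u^{-\ell(x)}T_x$. Then there is a unique isomorphism of left $\mathcal{H}^{\mathbb{Q}(u)}$-modules $\eta:\mathbb{Q}(u)\otimes_{\mathcal{A}}M\xrightarrow{\ \sim\ }\mathcal{H}^{\mathbb{Q}(u)}X_{\emptyset}$ such that $\eta(a_1)=X_{\emptyset}$.
   Context: $u$ is an indeterminate, $\mathcal{A}=\mathbb{Z}[u,u^{-1}]$. $\mathcal{H}_u$ is the Iwahori–Hecke algebra of $\mathfrak{S}_n$ over $\mathcal{A}$ with parameter $u^2$: free $\mathcal{A}$-module with basis $\{T_w\}_{w\in\mathfrak{S}_n}$, unit $T_1$, $T_wT_{w'}=T_{ww'}$ if $\ell(ww')=\ell(w)+\ell(w')$, and $(T_s+1)(T_s-u^2)=0$ for $s\in S$; $\ell$ is the Coxeter length. $\mathcal{H}^{\mathbb{Q}(u)}=\mathbb{Q}(u)\otimes_{\mathcal{A}}\mathcal{H}_u$. Let $I_\ast=\{w\in\mathfrak{S}_n: w^2=1\}$. $M$ is the free $\mathcal{A}$-module with basis $\{a_w: w\in I_\ast\}$, endowed with the (unique, by Lusztig–Vogan) $\mathcal{H}_u$-module structure such that for $s\in S$, $w\in I_\ast$: $T_sa_w=ua_w+(u+1)a_{sw}$ if $sw=ws$ and $\ell(sw)>\ell(w)$;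 $T_sa_w=(u^2-u-1)a_w+(u^2-u)a_{sw}$ if $sw=ws$ and $\ell(sw)<\ell(w)$; $T_sa_w=a_{sws}$ if $sw\neq ws$ and $\ell(sw)>\ell(w)$; $T_sa_w=(u^2-1)a_w+u^2a_{sws}$ if $sw\neq ws$ and $\ell(sw)<\ell(w)$. *)

theory Defs
  imports "HOL-Combinatorics.Combinatorics" "HOL-Computational_Algebra.Polynomial"
          "HOL-Computational_Algebra.Fraction_Field"
begin

type_synonym K = "rat poly fract"
type_synonym perm = "nat \<Rightarrow> nat"
type_synonym vec = "perm \<Rightarrow> K"

definition uu :: K where "uu = Fract [:0, 1:] 1"

definition sref :: "nat \<Rightarrow> perm" where "sref i = transpose i (Suc i)"
definition perms :: "nat \<Rightarrow> perm set" where "perms n = {w. w permutes {1..n}}"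
definition invols :: "nat \<Rightarrow> perm set" where "invols n = {w \<in> perms n. w \<circ> w = id}"

definition word_perm :: "nat list \<Rightarrow> perm" where
  "word_perm is = foldr (\<lambda>i p. sref i \<circ> p) is id"
definition simple_word :: "nat \<Rightarrow> nat list \<Rightarrow> bool" where
  "simple_word n is \<longleftrightarrow> set is \<subseteq> {1..<n}"

definition cox_len :: "nat \<Rightarrow> perm \<Rightarrow> nat" where
  "cox_len n w = (LEAST k. \<exists>is. simple_word n is \<and> length is = k \<and> word_perm is = w)"
definition reduced_word :: "nat \<Rightarrow> perm \<Rightarrow> nat list" where
  "reduced_word n w = (SOME is. simple_word n is \<and> word_perm is = w \<and> length is = cox_len n w)"

definition bas :: "perm \<Rightarrow> vec" where "bas w = (\<lambda>v. if v = w then 1 else 0)"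

text \<open>H^{Q(u)}: Q(u)-vector space with basis T_w (w in S_n), as coefficient functions.\<close>
definition Hvec :: "nat \<Rightarrow> vec set" where "Hvec n = {h. \<forall>w. w \<notin> perms n \<longrightarrow> h w = 0}"

definition hecke_Ts_basis :: "nat \<Rightarrow> nat \<Rightarrow> perm \<Rightarrow> vec" where
  "hecke_Ts_basis n i w =
     (if cox_len n (sref i \<circ> w) > cox_len n w then bas (sref i \<circ> w)
      else (\<lambda>v. (uu^2 - 1) * bas w v + uu^2 * bas (sref i \<circ> w) v))"
definition hecke_Ts :: "nat \<Rightarrow> nat \<Rightarrow> vec \<Rightarrow> vec" where
  "hecke_Ts n i h = (\<lambda>v. \<Sum>w\<in>perms n. h w * hecke_Ts_basis n i w v)"
text \<open>Left multiplication by T_w = T_(s_i1) ... T_(s_ik) for a reduced word.\<close>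
definition hecke_Tw :: "nat \<Rightarrow> perm \<Rightarrow> vec \<Rightarrow> vec" where
  "hecke_Tw n w = foldr (\<lambda>i f. hecke_Ts n i \<circ> f) (reduced_word n w) id"
definition hecke_mult :: "nat \<Rightarrow> vec \<Rightarrow> vec \<Rightarrow> vec" where
  "hecke_mult n h g = (\<lambda>v. \<Sum>w\<in>perms n. h w * hecke_Tw n w g v)"

definition X_empty :: "nat \<Rightarrow> vec" where
  "X_empty n = (\<lambda>w. if w \<in> perms n then inverse uu ^ cox_len n w else 0)"
definition HX :: "nat \<Rightarrow> vec set" where
  "HX n = {hecke_mult n h (X_empty n) | h. h \<in> Hvec n}"

text \<open>Q(u) \<otimes>_A M: Q(u)-vector space with basis a_w (w involution).\<close>
definition Mvec :: "nat \<Rightarrow> vec set" where "Mvec n = {m. \<forall>w. w \<notin> invols n \<longrightarrow> m w = 0}"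

definition M_Ts_basis :: "nat \<Rightarrow> nat \<Rightarrow> perm \<Rightarrow> vec" where
  "M_Ts_basis n i w =
    (let s = sref i in
     if s \<circ> w = w \<circ> s then
       (if cox_len n (s \<circ> w) > cox_len n w
        then (\<lambda>v. uu * bas w v + (uu + 1) * bas (s \<circ> w) v)
        else (\<lambda>v. (uu^2 - uu - 1) * bas w v + (uu^2 - uu) * bas (s \<circ> w) v))
     else
       (if cox_len n (s \<circ> w) > cox_len n w
        then bas (s \<circ> w \<circ> s)
        else (\<lambda>v. (uu^2 - 1) * bas w v + uu^2 * bas (s \<circ> w \<circ> s) v)))"
definition M_Ts :: "nat \<Rightarrow> nat \<Rightarrow> vec \<Rightarrow> vec" where
  "M_Ts n i m = (\<lambda>v. \<Sum>w\<in>invols n. m w * M_Ts_basis n i w v)"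
definition M_Tw :: "nat \<Rightarrow> perm \<Rightarrow> vec \<Rightarrow> vec" where
  "M_Tw n w = foldr (\<lambda>i f. M_Ts n i \<circ> f) (reduced_word n w) id"
definition M_act :: "nat \<Rightarrow> vec \<Rightarrow> vec \<Rightarrow> vec" where
  "M_act n h m = (\<lambda>v. \<Sum>w\<in>perms n. h w * M_Tw n w m v)"

definition is_Hiso :: "nat \<Rightarrow> (vec \<Rightarrow> vec) \<Rightarrow> bool" where
  "is_Hiso n \<eta> \<longleftrightarrow> bij_betw \<eta> (Mvec n) (HX n)
     \<and> (\<forall>m\<in>Mvec n. \<forall>m'\<in>Mvec n. \<eta> (\<lambda>v. m v + m' v) = (\<lambda>v. \<eta> m v + \<eta> m' v))
     \<and> (\<forall>h\<in>Hvec n. \<forall>m\<in>Mvec n. \<eta> (M_act n h m) = hecke_mult n h (\<eta> m))"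

end

theory Submission
  imports Defs
begin

text \<open>
  For the diagonal form on \<open>M\<close> with weights \<open>N(w) = u\<^bsup>l(w)\<^esup> ((u - 1) / (u + 1))\<^bsup>c(w)\<^esup>\<close>, where \<open>c(w)\<close>
  is the number of 2-cycles of \<open>w\<close>, every \<open>T\<^sub>s\<close> is self-adjoint. Since the Hecke algebra is a symmetric
  algebra, the map \<open>m \<mapsto> \<Sum>\<^sub>w u\<^bsup>-2l(w)\<^esup> (T\<^sub>w a\<^sub>1, m) T\<^sub>w\<close> is then equivariant, provided that the operators
  \<open>T\<^sub>s\<close> on \<open>M\<close> satisfy the quadratic and braid relations. It sends \<open>a\<^sub>1\<close> to \<open>X\<^sub>\<emptyset>\<close> because the
  coefficient of \<open>a\<^sub>1\<close> in \<open>T\<^sub>w a\<^sub>1\<close> is \<open>u\<^bsup>l(w)\<^esup>\<close>, and it is injective because the form is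
  nondegenerate and the \<open>T\<^sub>w a\<^sub>1\<close> span \<open>M\<close>. Cyclicity of \<open>M\<close> also gives surjectivity and uniqueness.

  The braid defect \<open>D = T\<^sub>sT\<^sub>tT\<^sub>s - T\<^sub>tT\<^sub>sT\<^sub>t\<close> satisfies \<open>D T\<^sub>t = (u\<^sup>2 - 1 - T\<^sub>s) D\<close> by the quadratic relations, so
  its kernel is stable under \<open>T\<^sub>s\<close> and \<open>T\<^sub>t\<close>, and \<open>D a\<^sub>w = 0\<close> has to be checked only for those \<open>w\<close> that
  have neither \<open>s\<close> nor \<open>t\<close> as a descent.
\<close>

section \<open>Length in the symmetric group\<close>

lemma sref_sref [simp]: "sref i (sref i a) = a"
  by (simp add: sref_def)

lemma sref_comp_sref [simp]: "sref i \<circ> sref i = id" "sref i \<circ> (sref i \<circ> w) = w"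
  "w \<circ> sref i \<circ> sref i = w"
  by (auto simp: fun_eq_iff)

lemma sref_simps [simp]: "sref i i = Suc i" "sref i (Suc i) = i"
  "a \<noteq> i \<Longrightarrow> a \<noteq> Suc i \<Longrightarrow> sref i a = a"
  by (simp_all add: sref_def)

lemma sref_eq_iff [simp]: "sref i a = sref i b \<longleftrightarrow> a = b"
  by (metis sref_sref)

lemma sref_eq_swap: "sref i a = b \<longleftrightarrow> a = sref i b"
  by auto

text \<open>No integer lies strictly between \<open>i\<close> and \<open>Suc i\<close>, so the
  exchange can reverse the order of these two points only.\<close>

lemma sref_less_iff: "{a, b} \<noteq> {i, Suc i} \<Longrightarrow> sref i a < sref i b \<longleftrightarrow> a < b"
  by (auto simp: sref_def transpose_def)

lemma bij_sref [simp]: "bij (sref i)" by (simp add: sref_def)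

lemma inv_sref [simp]: "inv (sref i) = sref i"
  by (rule inv_unique_comp) auto

lemma sref_permutes: "i \<in> {1..<n} \<Longrightarrow> sref i permutes {1..n}"
  unfolding sref_def by (intro permutes_swap_id) auto

lemma sref_perms: "i \<in> {1..<n} \<Longrightarrow> sref i \<in> perms n"
  using sref_permutes unfolding perms_def by blast

lemma perms_comp: "v \<in> perms n \<Longrightarrow> w \<in> perms n \<Longrightarrow> v \<circ> w \<in> perms n"
  by (simp add: perms_def permutes_compose)

lemma perms_inv: "w \<in> perms n \<Longrightarrow> inv w \<in> perms n"
  by (simp add: perms_def permutes_inv)

lemma id_perms [simp]: "id \<in> perms n"
  by (simp add: perms_def permutes_id)

lemma perms_bij: "w \<in> perms n \<Longrightarrow> bij w"
  by (auto simp: perms_def permutes_bij)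

lemma perms_eq_iff [simp]: "w \<in> perms n \<Longrightarrow> w a = w b \<longleftrightarrow> a = b"
  by (meson bij_def inj_eq perms_bij)

lemma inv_eq_iff: "w \<in> perms n \<Longrightarrow> inv w a = inv w b \<longleftrightarrow> a = b"
  using perms_eq_iff perms_inv by blast

lemma inv_sref_comp: "w \<in> perms n \<Longrightarrow> inv (sref i \<circ> w) = inv w \<circ> sref i"
  by (simp add: o_inv_distrib perms_bij)

lemma finite_perms [simp]: "finite (perms n)"
  by (simp add: perms_def finite_permutations)

lemma perms_in: "w \<in> perms n \<Longrightarrow> w a \<in> {1..n} \<longleftrightarrow> a \<in> {1..n}"
  unfolding perms_def by (simp add: permutes_in_image del: atLeastAtMost_iff)

lemma sref_comp_perms: "i \<in> {1..<n} \<Longrightarrow> w \<in> perms n \<Longrightarrow> sref i \<circ> w \<in> perms n"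
  "i \<in> {1..<n} \<Longrightarrow> w \<in> perms n \<Longrightarrow> w \<circ> sref i \<in> perms n"
  by (simp_all add: perms_comp sref_perms)

text \<open>Inversions of the inverse of \<open>w\<close>, which are the ones affected by multiplication from the left.\<close>

definition inversions :: "nat \<Rightarrow> perm \<Rightarrow> (nat \<times> nat) set" where
  "inversions n w = {(a, b). a \<in> {1..n} \<and> b \<in> {1..n} \<and> a < b \<and> inv w b < inv w a}"

lemma finite_inversions: "finite (inversions n w)"
  by (rule finite_subset[of _ "{1..n} \<times> {1..n}"]) (auto simp: inversions_def)

text \<open>\<open>sref i\<close> preserves the order of every pair except \<open>i\<close>,
  \<open>Suc i\<close>, so it transports the old inversions; by \<open>asc\<close> the exceptional
  pair is the one new inversion.\<close>

lemma inversions_sref: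
  assumes w: "w \<in> perms n" and i: "i \<in> {1..<n}" and asc: "inv w i < inv w (Suc i)"
  shows "inversions n (sref i \<circ> w) = insert (i, Suc i) (map_prod (sref i) (sref i) ` inversions n w)"
proof (intro set_eqI)
  fix p :: "nat \<times> nat"
  obtain a b where p: "p = (a, b)" by force
  have img: "p \<in> map_prod (sref i) (sref i) ` inversions n w \<longleftrightarrow> (sref i a, sref i b) \<in> inversions n w"
    by (force simp: p image_iff)
  have s: "sref i c \<in> {1..n} \<longleftrightarrow> c \<in> {1..n}" for c
    using perms_in[OF sref_perms[OF i]] by blast
  show "p \<in> inversions n (sref i \<circ> w) \<longleftrightarrow> p \<in> insert (i, Suc i) (map_prod (sref i) (sref i) ` inversions n w)"
  proof (cases "{a, b} = {i, Suc i}")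
    case True
    then have "p = (i, Suc i) \<or> p = (Suc i, i)" by (auto simp: p doubleton_eq_iff)
    then show ?thesis
    proof
      assume "p = (i, Suc i)"
      then show ?thesis using i asc by (simp add: inversions_def inv_sref_comp[OF w])
    next
      assume "p = (Suc i, i)"
      then show ?thesis unfolding insert_iff img using asc by (auto simp: inversions_def p)
    qed
  next
    case False
    then have "p \<noteq> (i, Suc i)" by (auto simp: p)
    then show ?thesis
      unfolding insert_iff img using sref_less_iff[OF False]
      by (auto simp: p inversions_def inv_sref_comp[OF w] s simp del: atLeastAtMost_iff One_nat_def)
  qed
qed

lemma card_inversions_up:
  assumes w: "w \<in> perms n" and i: "i \<in> {1..<n}" and asc: "inv w i < inv w (Suc i)"
  shows "card (inversions n (sref i \<circ> w)) = Suc (card (inversions n w))"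
proof -
  \<comment> \<open>Its preimage \<open>(Suc i, i)\<close> is not an increasing pair, so the
    inserted element is new.\<close>
  have "(i, Suc i) \<notin> map_prod (sref i) (sref i) ` inversions n w"
    by (auto simp: inversions_def sref_eq_swap dest!: sym[of _ "sref i _"])
  moreover have "inj_on (map_prod (sref i) (sref i)) (inversions n w)"
    by (auto simp: inj_on_def)
  ultimately show ?thesis
    by (simp add: inversions_sref[OF assms] finite_inversions card_image)
qed

lemma card_inversions_down:
  assumes w: "w \<in> perms n" and i: "i \<in> {1..<n}" and desc: "inv w (Suc i) < inv w i"
  shows "card (inversions n w) = Suc (card (inversions n (sref i \<circ> w)))"
  using card_inversions_up[of "sref i \<circ> w" n i] sref_comp_perms(1)[OF i w] i desc
  by (simp add: inv_sref_comp[OF w])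

section \<open>Words in adjacent transpositions, and length as the number of inversions\<close>

lemma word_perm_simps [simp]: "word_perm [] = id" "word_perm (i # is) = sref i \<circ> word_perm is"
  by (simp_all add: word_perm_def)

lemma word_perm_append: "word_perm (is @ js) = word_perm is \<circ> word_perm js"
  by (induction "is") (auto simp: o_assoc)

lemma simple_word_simps [simp]: "simple_word n []"
  "simple_word n (i # is) \<longleftrightarrow> i \<in> {1..<n} \<and> simple_word n is"
  "simple_word n (is @ js) \<longleftrightarrow> simple_word n is \<and> simple_word n js"
  by (auto simp: simple_word_def)

lemma word_perm_perms: "simple_word n is \<Longrightarrow> word_perm is \<in> perms n"
  by (induction "is") (auto intro!: sref_comp_perms)

lemma inv_word_perm: "inv (word_perm is) = word_perm (rev is)"
proof (rule inv_unique_comp)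
  show "word_perm is \<circ> word_perm (rev is) = id"
    by (induction "is") (auto simp: word_perm_append fun_eq_iff)
  show "word_perm (rev is) \<circ> word_perm is = id"
    by (induction "is") (auto simp: word_perm_append fun_eq_iff)
qed

lemma inversions_id: "inversions n id = {}"
  by (auto simp: inversions_def)

text \<open>One letter changes the number of inversions by exactly one. This bounds the length from
  below; sorting, in \<open>exists_word_card_inversions\<close>, gives the upper bound.\<close>

lemma card_inversions_le_length: "simple_word n is \<Longrightarrow> card (inversions n (word_perm is)) \<le> length is"
proof (induction "is")
  case Nil
  show ?case unfolding word_perm_simps inversions_id by simp
next
  case (Cons i "is")
  let ?w = "word_perm is"
  have w: "?w \<in> perms n" and i: "i \<in> {1..<n}" using Cons.prems word_perm_perms by auto
  have "inv ?w i \<noteq> inv ?w (Suc i)" by (simp add: inv_eq_iff[OF w])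
  then consider "inv ?w i < inv ?w (Suc i)" | "inv ?w (Suc i) < inv ?w i" by linarith
  then have "card (inversions n (sref i \<circ> ?w)) \<le> Suc (card (inversions n ?w))"
    by cases (use card_inversions_up[OF w i] card_inversions_down[OF w i] in auto)
  then show ?case using Cons by (simp add: comp_def)
qed

lemma perms_ascending_id:
  assumes w: "w \<in> perms n" and asc: "\<And>i. i \<in> {1..<n} \<Longrightarrow> w i < w (Suc i)"
  shows "w = id"
proof (rule permutes_natset_ge)
  show "w permutes {1..n}" using w by (simp add: perms_def)
  have "i \<in> {1..n} \<Longrightarrow> i \<le> w i" for i
  proof (induction i)
    case (Suc i)
    show ?case
    proof (cases "i = 0")
      case True
      then show ?thesis using perms_in[OF w, of "Suc i"] Suc.prems by auto
    next
      case False
      then show ?thesis using Suc asc[of i] by auto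
    qed
  qed simp
  then show "\<forall>i\<in>{1..n}. i \<le> w i" by blast
qed

text \<open>Removing left descents one at a time sorts \<open>w\<close>; every removal uses one
  letter and destroys one inversion.\<close>

lemma exists_word_card_inversions:
  "w \<in> perms n \<Longrightarrow> \<exists>is. simple_word n is \<and> length is = card (inversions n w) \<and> word_perm is = w"
proof (induction "card (inversions n w)" arbitrary: w rule: less_induct)
  case less
  show ?case
  proof (cases "\<exists>i\<in>{1..<n}. inv w (Suc i) < inv w i")
    case True
    then obtain i where i: "i \<in> {1..<n}" "inv w (Suc i) < inv w i" by blast
    have c: "card (inversions n w) = Suc (card (inversions n (sref i \<circ> w)))"
      by (rule card_inversions_down[OF less.prems i])
    then obtain js where "simple_word n js" "length js = card (inversions n (sref i \<circ> w))"
        "word_perm js = sref i \<circ> w"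
      using less.hyps[of "sref i \<circ> w"] sref_comp_perms(1)[OF i(1) less.prems] by auto
    then show ?thesis using i c by (intro exI[of _ "i # js"]) simp
  next
    case False
    have "inv w = id"
    proof (rule perms_ascending_id[OF perms_inv[OF less.prems]])
      fix i assume "i \<in> {1..<n}"
      with False show "inv w i < inv w (Suc i)"
        by (meson inv_eq_iff[OF less.prems] linorder_neqE_nat n_not_Suc_n)
    qed
    then have "w = id" by (metis inv_id inv_inv_eq less.prems perms_bij)
    then show ?thesis by (intro exI[of _ "[]"]) (simp add: inversions_id \<open>w = id\<close>)
  qed
qed

lemma cox_len_eq_card_inversions: "w \<in> perms n \<Longrightarrow> cox_len n w = card (inversions n w)"
  unfolding cox_len_def
  by (rule Least_equality) (use exists_word_card_inversions card_inversions_le_length in auto)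

lemma cox_len_up:
  assumes "w \<in> perms n" "i \<in> {1..<n}" "inv w i < inv w (Suc i)"
  shows "cox_len n (sref i \<circ> w) = Suc (cox_len n w)"
  using assms card_inversions_up by (simp add: cox_len_eq_card_inversions sref_comp_perms)

lemma cox_len_down:
  assumes "w \<in> perms n" "i \<in> {1..<n}" "inv w (Suc i) < inv w i"
  shows "cox_len n w = Suc (cox_len n (sref i \<circ> w))"
  using assms card_inversions_down by (simp add: cox_len_eq_card_inversions sref_comp_perms)

text \<open>Replaces the length tests in the definitions of the two actions by a comparison of two
  values.\<close>

lemma cox_len_sref_greater_iff:
  assumes "w \<in> perms n" "i \<in> {1..<n}"
  shows "cox_len n w < cox_len n (sref i \<circ> w) \<longleftrightarrow> inv w i < inv w (Suc i)"
  using cox_len_up[OF assms] cox_len_down[OF assms] inv_eq_iff[OF assms(1), of i "Suc i"]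
  by (metis lessI linorder_neqE_nat n_not_Suc_n not_less_iff_gr_or_eq)

lemma cox_len_id [simp]: "cox_len n id = 0"
  by (simp add: cox_len_eq_card_inversions inversions_id)

lemma cox_len_le: "simple_word n is \<Longrightarrow> cox_len n (word_perm is) \<le> length is"
  unfolding cox_len_def by (rule Least_le) auto

definition is_reduced :: "nat \<Rightarrow> nat list \<Rightarrow> bool" where
  "is_reduced n is \<longleftrightarrow> simple_word n is \<and> length is = cox_len n (word_perm is)"

lemma reduced_word:
  assumes "w \<in> perms n"
  shows "is_reduced n (reduced_word n w)" "word_perm (reduced_word n w) = w"
proof -
  have "\<exists>is. simple_word n is \<and> word_perm is = w \<and> length is = cox_len n w"
    using exists_word_card_inversions[OF assms] cox_len_eq_card_inversions[OF assms] by auto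
  from someI_ex[OF this] show "is_reduced n (reduced_word n w)" "word_perm (reduced_word n w) = w"
    by (auto simp: reduced_word_def is_reduced_def)
qed

lemma cox_len_inv:
  assumes "w \<in> perms n"
  shows "cox_len n (inv w) = cox_len n w"
proof -
  have le: "cox_len n (inv v) \<le> cox_len n v" if "v \<in> perms n" for v
    using cox_len_le[of n "rev (reduced_word n v)"] reduced_word[OF that] inv_word_perm
    by (metis is_reduced_def length_rev set_rev simple_word_def)
  show ?thesis
    using le[OF assms] le[OF perms_inv[OF assms]] by (simp add: inv_inv_eq perms_bij[OF assms])
qed

text \<open>One letter changes the length by one, so the tail of a reduced word is reduced and the
  first letter must be an ascent of the tail.\<close>

lemma is_reduced_Cons_iff:
  "is_reduced n (i # is) \<longleftrightarrow>
    is_reduced n is \<and> i \<in> {1..<n} \<and> inv (word_perm is) i < inv (word_perm is) (Suc i)"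
proof (cases "simple_word n is \<and> i \<in> {1..<n}")
  case True
  then have w: "word_perm is \<in> perms n" and i: "i \<in> {1..<n}" by (auto intro: word_perm_perms)
  show ?thesis
    using True cox_len_up[OF w i] cox_len_down[OF w i] cox_len_le[of n "is"]
      inv_eq_iff[OF w, of i "Suc i"]
    by (auto simp: is_reduced_def nat_neq_iff)
qed (auto simp: is_reduced_def)

section \<open>Reduced words\<close>

text \<open>\<open>M_Tw\<close> and \<open>hecke_Tw\<close> are the instances at
  \<open>M_Ts n\<close> and \<open>hecke_Ts n\<close> with the chosen reduced word.\<close>

definition act_word :: "(nat \<Rightarrow> 'a \<Rightarrow> 'a) \<Rightarrow> nat list \<Rightarrow> 'a \<Rightarrow> 'a" where
  "act_word T is = foldr (\<lambda>i f. T i \<circ> f) is id"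

lemma act_word_simps [simp]: "act_word T [] x = x" "act_word T (i # is) x = T i (act_word T is x)"
  by (simp_all add: act_word_def)

lemma act_word_append: "act_word T (is @ js) x = act_word T is (act_word T js x)"
  by (induction "is") auto

lemma sref_commute: "Suc i < j \<Longrightarrow> sref i \<circ> (sref j \<circ> w) = sref j \<circ> (sref i \<circ> w)"
  by (auto simp: fun_eq_iff sref_def transpose_def)

lemma sref_braid:
  "sref i \<circ> (sref (Suc i) \<circ> (sref i \<circ> w)) = sref (Suc i) \<circ> (sref i \<circ> (sref (Suc i) \<circ> w))"
  by (auto simp: fun_eq_iff sref_def transpose_def)

lemma is_reducedD: "is_reduced n is \<Longrightarrow> simple_word n is"
  "is_reduced n is \<Longrightarrow> length is = cox_len n (word_perm is)"
  "is_reduced n is \<Longrightarrow> word_perm is \<in> perms n"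
  by (auto simp: is_reduced_def word_perm_perms)

lemma is_reduced_Cons_descent:
  assumes "is_reduced n (i # is)"
  shows "inv (word_perm (i # is)) (Suc i) < inv (word_perm (i # is)) i"
  using assms is_reducedD(3)[of n "is"]
  by (auto simp: is_reduced_Cons_iff inv_sref_comp)

text \<open>Matsumoto's theorem: two reduced words of \<open>w\<close> starting with \<open>i \<noteq> j\<close> are both compared with
  a word starting with the longest element of the parabolic subgroup generated by \<open>i\<close> and \<open>j\<close>.\<close>

theorem act_word_reduced_unique:
  fixes T :: "nat \<Rightarrow> 'a \<Rightarrow> 'a"
  assumes closed: "\<And>i x. i \<in> {1..<n} \<Longrightarrow> x \<in> A \<Longrightarrow> T i x \<in> A"
    and comm: "\<And>i j x. i \<in> {1..<n} \<Longrightarrow> j \<in> {1..<n} \<Longrightarrow> Suc i < j \<Longrightarrow> x \<in> A \<Longrightarrow>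
      T i (T j x) = T j (T i x)"
    and braid: "\<And>i x. i \<in> {1..<n} \<Longrightarrow> Suc i \<in> {1..<n} \<Longrightarrow> x \<in> A \<Longrightarrow>
      T i (T (Suc i) (T i x)) = T (Suc i) (T i (T (Suc i) x))"
    and red: "is_reduced n is" "is_reduced n js" "word_perm is = word_perm js"
    and x: "x \<in> A"
  shows "act_word T is x = act_word T js x"
  using red
proof (induction "length is" arbitrary: "is" js rule: less_induct)
  case less
  have closed_word: "act_word T ks x \<in> A" if "simple_word n ks" for ks
    using that by (induction ks) (auto intro!: closed x)
  \<comment> \<open>The claim is symmetric in the two words, so \<open>i < j\<close> may be
    assumed.\<close>
  have key: "act_word T (i # is') x = act_word T (j # js') x"
    if ij: "i < j" and ri: "is_reduced n (i # is')" and rj: "is_reduced n (j # js')"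
      and eq: "word_perm (i # is') = word_perm (j # js')" and len: "length (i # is') = length is"
    for i j is' js'
  proof -
    define w where "w = word_perm (i # is')"
    have w: "w \<in> perms n" using is_reducedD(3)[OF ri] by (simp add: w_def)
    have i: "i \<in> {1..<n}" and j: "j \<in> {1..<n}" using is_reducedD(1)[OF ri] is_reducedD(1)[OF rj] by auto
    have di: "inv w (Suc i) < inv w i" unfolding w_def by (rule is_reduced_Cons_descent[OF ri])
    have dj: "inv w (Suc j) < inv w j" unfolding w_def eq by (rule is_reduced_Cons_descent[OF rj])
    have lens: "length js' = length is'"
      using is_reducedD(2)[OF ri] is_reducedD(2)[OF rj] eq by simp
    have wi: "word_perm is' = sref i \<circ> w" by (simp add: w_def)
    have wj: "word_perm js' = sref j \<circ> w" unfolding w_def eq by simp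
    have ris: "is_reduced n is'" and rjs: "is_reduced n js'"
      using ri rj by (auto simp: is_reduced_Cons_iff)
    show ?thesis
    proof (cases "Suc i < j")
      case True
      \<comment> \<open>Both letters are left descents of \<open>w\<close>, so the longest element
        of the parabolic subgroup splits off on the left with lengths adding; \<open>w2\<close> is
        the remaining factor.\<close>
      define w2 where "w2 = sref j \<circ> (sref i \<circ> w)"
      have w2: "w2 \<in> perms n" unfolding w2_def by (intro sref_comp_perms i j w)
      have inv2: "inv w2 = inv w \<circ> sref i \<circ> sref j"
        by (simp add: w2_def inv_sref_comp[OF sref_comp_perms(1)[OF i w]] inv_sref_comp[OF w])
      define ks where "ks = reduced_word n w2"
      have ks: "is_reduced n ks" "word_perm ks = w2" using reduced_word[OF w2] by (auto simp: ks_def)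
      have "is_reduced n (j # ks)" "is_reduced n (i # ks)"
        using ks i j di dj True by (auto simp: is_reduced_Cons_iff inv2)
      moreover have "word_perm is' = word_perm (j # ks)" by (simp add: wi ks w2_def)
      moreover have "word_perm js' = word_perm (i # ks)"
        by (simp add: wj ks w2_def sref_commute[OF True, symmetric])
      \<comment> \<open>The tails are shorter than \<open>is\<close>, so the induction hypothesis
        replaces each by a word ending in the common part \<open>ks\<close>.\<close>
      ultimately have "act_word T is' x = act_word T (j # ks) x" "act_word T js' x = act_word T (i # ks) x"
        using less.hyps ris rjs len lens by auto
      then show ?thesis
        using comm[OF i j True closed_word[OF is_reducedD(1)[OF ks(1)]]] by simp
    next
      case False
      then have ji: "j = Suc i" using ij by simp
      \<comment> \<open>The longest element now has length three, and \<open>w3\<close> is what it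
        leaves of \<open>w\<close>.\<close>
      define w3 where "w3 = sref i \<circ> (sref j \<circ> (sref i \<circ> w))"
      have w3: "w3 \<in> perms n" unfolding w3_def by (intro sref_comp_perms i j w)
      have inv3: "inv w3 = inv w \<circ> sref i \<circ> sref j \<circ> sref i"
        using i j w by (simp add: w3_def inv_sref_comp[of _ n] sref_comp_perms)
      define ks where "ks = reduced_word n w3"
      have ks: "is_reduced n ks" "word_perm ks = w3" using reduced_word[OF w3] by (auto simp: ks_def)
      have "is_reduced n (j # i # ks)" "is_reduced n (i # j # ks)"
        using ks i j di dj w3
        by (auto simp: is_reduced_Cons_iff inv_sref_comp[of _ n] sref_comp_perms inv3 ji)
      moreover have "word_perm is' = word_perm (j # i # ks)" by (simp add: wi ks w3_def)
      moreover have "word_perm js' = word_perm (i # j # ks)"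
        by (simp add: wj ks w3_def ji sref_braid)
      ultimately have "act_word T is' x = act_word T (j # i # ks) x" "act_word T js' x = act_word T (i # j # ks) x"
        using less.hyps ris rjs len lens by auto
      then show ?thesis
        using braid[OF i _ closed_word[OF is_reducedD(1)[OF ks(1)]]] j by (simp add: ji)
    qed
  qed
  have len: "length is = length js" using less.prems by (simp add: is_reduced_def)
  show ?case
  proof (cases "is")
    case Nil
    then show ?thesis using len by simp
  next
    case (Cons i is')
    then obtain j js' where js: "js = j # js'" using len by (cases js) auto
    consider "i = j" | "i < j" | "j < i" by linarith
    then show ?thesis
    proof cases
      case 1
      have "word_perm is' = word_perm js'"
        using less.prems(3) unfolding Cons js 1 word_perm_simps by (metis sref_comp_sref(2))
      then show ?thesis
        using less.hyps[of is' js'] less.prems by (auto simp: Cons js 1 is_reduced_Cons_iff)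
    next
      case 2
      then show ?thesis using key[of i j is' js'] less.prems Cons js by simp
    next
      case 3
      then show ?thesis using key[of j i js' is'] less.prems Cons js len by simp
    qed
  qed
qed

section \<open>The involution module\<close>

text \<open>\<open>uu + 1\<close> is divided by when the module is generated from shorter
  involutions, and all three make the weights of the form nonzero.\<close>

lemma uu_nonzero [simp]: "uu \<noteq> 0" "uu + 1 \<noteq> 0" "uu - 1 \<noteq> 0"
  by (simp_all add: uu_def One_fract_def Zero_fract_def eq_fract one_pCons)

definition sref_conj :: "nat \<Rightarrow> perm \<Rightarrow> perm" where
  "sref_conj i w = sref i \<circ> w \<circ> sref i"

lemma sref_conj_apply [simp]: "sref_conj i w a = sref i (w (sref i a))"
  by (simp add: sref_conj_def)

lemma sref_conj_sref_conj [simp]: "sref_conj i (sref_conj i w) = w"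
  by (simp add: fun_eq_iff)

lemma invols_perms: "w \<in> invols n \<Longrightarrow> w \<in> perms n"
  by (simp add: invols_def)

lemma invols_app [simp]: "w \<in> invols n \<Longrightarrow> w (w a) = a"
  by (auto simp: invols_def fun_eq_iff)

lemma invols_eq_iff: "w \<in> invols n \<Longrightarrow> w a = w b \<longleftrightarrow> a = b"
  by (simp add: invols_perms[THEN perms_eq_iff])

lemma invols_eq_swap: "w \<in> invols n \<Longrightarrow> w a = b \<longleftrightarrow> w b = a"
  by auto

lemma invols_inv [simp]: "w \<in> invols n \<Longrightarrow> inv w = w"
  by (rule inv_unique_comp) (auto simp: fun_eq_iff)

lemma finite_invols [simp]: "finite (invols n)"
  by (rule finite_subset[OF _ finite_perms[of n]]) (auto simp: invols_perms)

lemma id_invols [simp]: "id \<in> invols n"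
  by (simp add: invols_def)

lemma sref_conj_invols: "i \<in> {1..<n} \<Longrightarrow> w \<in> invols n \<Longrightarrow> sref_conj i w \<in> invols n"
  unfolding sref_conj_def invols_def by (simp add: sref_comp_perms) (simp add: fun_eq_iff)

text \<open>Commuting with \<open>sref i\<close> means stabilising \<open>{i, Suc i}\<close>. An
  involution then fixes both points or swaps them, and \<open>w i = Suc i\<close> alone expresses
  the swap.\<close>

lemma sref_comm_iff:
  assumes w: "w \<in> invols n"
  shows "sref i \<circ> w = w \<circ> sref i \<longleftrightarrow> w i = i \<and> w (Suc i) = Suc i \<or> w i = Suc i"
proof
  assume "sref i \<circ> w = w \<circ> sref i"
  then have *: "sref i (w i) = w (Suc i)" by (metis comp_apply sref_simps(1))
  have "w i = i \<or> w i = Suc i"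
  proof (rule ccontr)
    assume "\<not> ?thesis"
    then have "w i = w (Suc i)" using * by simp
    then show False by (simp add: invols_eq_iff[OF w])
  qed
  then show "w i = i \<and> w (Suc i) = Suc i \<or> w i = Suc i" using * by auto
next
  assume h: "w i = i \<and> w (Suc i) = Suc i \<or> w i = Suc i"
  have "sref i (w a) = w (sref i a)" for a
  proof (cases "a = i \<or> a = Suc i")
    case True
    then show ?thesis using h invols_eq_swap[OF w, of i "Suc i"] by auto
  next
    case False
    then have "w a \<noteq> i \<and> w a \<noteq> Suc i"
      using h invols_eq_swap[OF w, of i "Suc i"] invols_eq_iff[OF w] by metis
    then show ?thesis using False by simp
  qed
  then show "sref i \<circ> w = w \<circ> sref i" by (simp add: fun_eq_iff)
qed

lemma sref_comp_invols:
  assumes "i \<in> {1..<n}" "w \<in> invols n" "w i = i \<and> w (Suc i) = Suc i \<or> w i = Suc i"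
  shows "sref i \<circ> w \<in> invols n"
proof -
  have "sref i \<circ> w \<circ> (sref i \<circ> w) = sref i \<circ> (w \<circ> sref i) \<circ> w" by (simp add: o_assoc)
  also have "\<dots> = id" using assms by (simp add: sref_comm_iff[symmetric] fun_eq_iff)
  finally show ?thesis
    using assms by (simp add: invols_def sref_comp_perms)
qed

text \<open>With scaling and addition bundled, linearity of an operator is a single rewrite
  rule.\<close>

definition lincomb :: "K \<Rightarrow> vec \<Rightarrow> K \<Rightarrow> vec \<Rightarrow> vec" where
  "lincomb a f b g = (\<lambda>v. a * f v + b * g v)"

lemma M_Ts_lincomb: "M_Ts n i (lincomb a f b g) = lincomb a (M_Ts n i f) b (M_Ts n i g)"
  by (simp add: M_Ts_def lincomb_def distrib_right sum.distrib sum_distrib_left mult.assoc)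

lemma M_Ts_bas: "w \<in> invols n \<Longrightarrow> M_Ts n i (bas w) = M_Ts_basis n i w"
  by (rule ext) (simp add: M_Ts_def bas_def if_distrib[of "\<lambda>x. x * _"] sum.delta cong: if_cong)

lemma cox_len_sref_iff:
  assumes "w \<in> invols n" "i \<in> {1..<n}"
  shows "cox_len n w < cox_len n (sref i \<circ> w) \<longleftrightarrow> w i < w (Suc i)"
  using cox_len_sref_greater_iff[OF invols_perms[OF assms(1)] assms(2)] assms(1) by simp

text \<open>Here and in the next three lemmas the commutation and length tests of the action are
  replaced by the values of \<open>w\<close> at \<open>i\<close> and \<open>Suc i\<close>.\<close>

lemma M_Ts_basis_fix:
  assumes "w \<in> invols n" "i \<in> {1..<n}" "w i = i" "w (Suc i) = Suc i"
  shows "M_Ts_basis n i w = lincomb uu (bas w) (uu + 1) (bas (sref i \<circ> w))"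
  using assms by (simp add: M_Ts_basis_def Let_def cox_len_sref_iff sref_comm_iff lincomb_def)

lemma M_Ts_basis_swap:
  assumes "w \<in> invols n" "i \<in> {1..<n}" "w i = Suc i"
  shows "M_Ts_basis n i w = lincomb (uu^2 - uu - 1) (bas w) (uu^2 - uu) (bas (sref i \<circ> w))"
  using assms invols_eq_swap[OF assms(1), of i "Suc i"]
  by (simp add: M_Ts_basis_def Let_def cox_len_sref_iff sref_comm_iff lincomb_def)

lemma M_Ts_basis_up:
  assumes "w \<in> invols n" "i \<in> {1..<n}" "w i < w (Suc i)" "\<not> (w i = i \<and> w (Suc i) = Suc i)"
  shows "M_Ts_basis n i w = bas (sref_conj i w)"
  using assms invols_eq_swap[OF assms(1), of i "Suc i"]
  by (auto simp add: M_Ts_basis_def Let_def cox_len_sref_iff sref_comm_iff sref_conj_def)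

lemma M_Ts_basis_down:
  assumes "w \<in> invols n" "i \<in> {1..<n}" "w (Suc i) < w i" "w i \<noteq> Suc i"
  shows "M_Ts_basis n i w = lincomb (uu^2 - 1) (bas w) (uu^2) (bas (sref_conj i w))"
  using assms by (auto simp add: M_Ts_basis_def Let_def cox_len_sref_iff sref_comm_iff sref_conj_def lincomb_def)

lemma invols_cases [consumes 1, case_names fixed swap up down]:
  assumes "w \<in> invols n"
  obtains "w i = i" "w (Suc i) = Suc i" | "w i = Suc i" "w (Suc i) = i"
    | "w i < w (Suc i)" "\<not> (w i = i \<and> w (Suc i) = Suc i)"
    | "w (Suc i) < w i" "w i \<noteq> Suc i"
proof -
  have "w i \<noteq> w (Suc i)" by (simp add: invols_eq_iff[OF assms])
  then show thesis using that invols_eq_swap[OF assms, of i "Suc i"] by (metis linorder_neqE_nat)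
qed

section \<open>Subspaces, and generation of the module by descent-free involutions\<close>

definition K_subspace :: "vec set \<Rightarrow> bool" where
  "K_subspace U \<longleftrightarrow> (\<lambda>v. 0) \<in> U \<and> (\<forall>a b. \<forall>f\<in>U. \<forall>g\<in>U. lincomb a f b g \<in> U)"

lemma K_subspace_lincomb: "K_subspace U \<Longrightarrow> f \<in> U \<Longrightarrow> g \<in> U \<Longrightarrow> lincomb a f b g \<in> U"
  by (simp add: K_subspace_def)

lemma K_subspace_sum:
  assumes "K_subspace U" "finite A" "\<And>w. w \<in> A \<Longrightarrow> g w \<in> U"
  shows "(\<lambda>v. \<Sum>w\<in>A. c w * g w v) \<in> U"
  using assms(2,3)
proof (induction A)
  case empty
  then show ?case using assms(1) by (simp add: K_subspace_def)
next
  case (insert w A)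
  then have "lincomb (c w) (g w) 1 (\<lambda>v. \<Sum>w\<in>A. c w * g w v) \<in> U"
    by (intro K_subspace_lincomb assms(1)) auto
  then show ?case using insert.hyps by (simp add: lincomb_def)
qed

lemma Mvec_sum_bas: "m \<in> Mvec n \<Longrightarrow> m = (\<lambda>v. \<Sum>w\<in>invols n. m w * bas w v)"
  by (rule ext) (simp add: Mvec_def bas_def if_distrib[of "\<lambda>x. _ * x"] sum.delta cong: if_cong)

lemma Mvec_subset_K_subspace:
  assumes "K_subspace U" "\<And>w. w \<in> invols n \<Longrightarrow> bas w \<in> U"
  shows "Mvec n \<subseteq> U"
proof
  fix m assume "m \<in> Mvec n"
  then show "m \<in> U"
    by (subst Mvec_sum_bas[of m n]) (simp_all add: K_subspace_sum assms)
qed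

lemma K_subspace_Mvec: "K_subspace (Mvec n)"
  by (auto simp: K_subspace_def Mvec_def lincomb_def)

lemma bas_Mvec: "w \<in> invols n \<Longrightarrow> bas w \<in> Mvec n"
  by (auto simp: Mvec_def bas_def)

lemma M_Ts_basis_Mvec:
  assumes w: "w \<in> invols n" and i: "i \<in> {1..<n}"
  shows "M_Ts_basis n i w \<in> Mvec n"
  using w
proof (cases rule: invols_cases[where i = i])
  case fixed
  then show ?thesis unfolding M_Ts_basis_fix[OF w i fixed]
    by (intro K_subspace_lincomb K_subspace_Mvec bas_Mvec w sref_comp_invols i) simp
next
  case swap
  then show ?thesis unfolding M_Ts_basis_swap[OF w i swap(1)]
    by (intro K_subspace_lincomb K_subspace_Mvec bas_Mvec w sref_comp_invols i) simp
next
  case up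
  then show ?thesis unfolding M_Ts_basis_up[OF w i up]
    by (intro K_subspace_lincomb K_subspace_Mvec bas_Mvec w sref_conj_invols i)
next
  case down
  then show ?thesis unfolding M_Ts_basis_down[OF w i down]
    by (intro K_subspace_lincomb K_subspace_Mvec bas_Mvec w sref_conj_invols i)
qed

lemma M_Ts_Mvec: "i \<in> {1..<n} \<Longrightarrow> M_Ts n i m \<in> Mvec n"
  unfolding M_Ts_def by (rule K_subspace_sum[OF K_subspace_Mvec finite_invols]) (rule M_Ts_basis_Mvec)

text \<open>Each side contributes one. The second factor still raises the length because
  \<open>{w i, w (Suc i)}\<close> is not \<open>{i, Suc i}\<close>, so \<open>sref i\<close> keeps
  the order of these values.\<close>

lemma cox_len_sref_conj:
  assumes w: "w \<in> invols n" and i: "i \<in> {1..<n}"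
    and up: "w i < w (Suc i)" "\<not> (w i = i \<and> w (Suc i) = Suc i)"
  shows "cox_len n (sref_conj i w) = cox_len n w + 2"
proof -
  have p: "w \<in> perms n" by (rule invols_perms[OF w])
  have inv: "inv (w \<circ> sref i) = sref i \<circ> w"
    using w p by (simp add: o_inv_distrib perms_bij)
  have "{w i, w (Suc i)} \<noteq> {i, Suc i}" using up by (auto simp: doubleton_eq_iff)
  then have "sref i (w i) < sref i (w (Suc i))" using sref_less_iff up by blast
  then have "cox_len n (sref i \<circ> (w \<circ> sref i)) = Suc (cox_len n (w \<circ> sref i))"
    by (intro cox_len_up sref_comp_perms i p) (simp add: inv)
  also have "cox_len n (w \<circ> sref i) = cox_len n (sref i \<circ> w)"
    using cox_len_inv[OF sref_comp_perms(2)[OF i p]] inv by simp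
  also have "cox_len n (sref i \<circ> w) = Suc (cox_len n w)"
    using up w by (intro cox_len_up i p) simp
  finally show ?thesis by (simp add: sref_conj_def comp_def)
qed

lemma cox_len_sref_conj_down:
  assumes w: "w \<in> invols n" and i: "i \<in> {1..<n}" and down: "w (Suc i) < w i" "w i \<noteq> Suc i"
  shows "cox_len n w = cox_len n (sref_conj i w) + 2" "sref_conj i w i < sref_conj i w (Suc i)"
    "\<not> (sref_conj i w i = i \<and> sref_conj i w (Suc i) = Suc i)"
proof -
  have "{w (Suc i), w i} \<noteq> {i, Suc i}" using down by (auto simp: doubleton_eq_iff)
  then show *: "sref_conj i w i < sref_conj i w (Suc i)" using sref_less_iff down by simp
  show **: "\<not> (sref_conj i w i = i \<and> sref_conj i w (Suc i) = Suc i)"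
    using down by (auto simp: sref_eq_swap)
  show "cox_len n w = cox_len n (sref_conj i w) + 2"
    using cox_len_sref_conj[OF sref_conj_invols[OF i w] i * **] unfolding sref_conj_sref_conj .
qed

text \<open>A descent \<open>i\<close> of \<open>w\<close> in \<open>I\<close> gives a shorter
  \<open>v\<close> such that \<open>M_Ts n i (bas v)\<close> contains \<open>bas w\<close> with the
  invertible coefficient 1 or \<open>uu + 1\<close>. With \<open>I\<close> of one or two elements
  this serves the Hecke relations, with all of \<open>{1..<n}\<close> cyclicity.\<close>

lemma Mvec_subset_generated:
  assumes U: "K_subspace U" and I: "I \<subseteq> {1..<n}"
    and closed: "\<And>i x. i \<in> I \<Longrightarrow> x \<in> U \<Longrightarrow> M_Ts n i x \<in> U"
    and min: "\<And>w. w \<in> invols n \<Longrightarrow> (\<And>i. i \<in> I \<Longrightarrow> w i < w (Suc i)) \<Longrightarrow> bas w \<in> U"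
  shows "Mvec n \<subseteq> U"
proof (rule Mvec_subset_K_subspace[OF U])
  fix w assume "w \<in> invols n"
  then show "bas w \<in> U"
  proof (induction "cox_len n w" arbitrary: w rule: less_induct)
    case less
    note w = less.prems
    show ?case
    proof (cases "\<forall>i\<in>I. w i < w (Suc i)")
      case True
      then show ?thesis using min w by blast
    next
      case False
      then obtain i where i: "i \<in> I" "\<not> w i < w (Suc i)" by blast
      with I have i': "i \<in> {1..<n}" by blast
      from w show ?thesis
      proof (cases rule: invols_cases[where i = i])
        case swap
        define v where "v = sref i \<circ> w"
        have v: "v \<in> invols n" unfolding v_def using swap by (intro sref_comp_invols i' w) auto
        have "cox_len n w = Suc (cox_len n v)"
          unfolding v_def using swap w by (intro cox_len_down i' invols_perms[OF w]) simp
        then have "bas v \<in> U" using less.hyps v by simp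
        \<comment> \<open>The coefficients solve T_i a_v = u a_v + (u + 1) a_w for a_w.\<close>
        then have "lincomb (- uu / (uu + 1)) (bas v) (1 / (uu + 1)) (M_Ts n i (bas v)) \<in> U"
          by (intro K_subspace_lincomb[OF U] closed i)
        also have "M_Ts n i (bas v) = lincomb uu (bas v) (uu + 1) (bas w)"
          using M_Ts_basis_fix[OF v i'] swap by (simp add: M_Ts_bas[OF v]) (simp add: v_def)
        also have "lincomb (- uu / (uu + 1)) (bas v) (1 / (uu + 1)) \<dots> = bas w"
          by (rule ext) (simp add: lincomb_def distrib_left)
        finally show ?thesis .
      next
        case down
        have v: "sref_conj i w \<in> invols n" by (rule sref_conj_invols[OF i' w])
        have "bas (sref_conj i w) \<in> U" using less.hyps v cox_len_sref_conj_down(1)[OF w i' down] by simp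
        then have "M_Ts n i (bas (sref_conj i w)) \<in> U" by (rule closed[OF i(1)])
        then show ?thesis
          unfolding M_Ts_bas[OF v] M_Ts_basis_up[OF v i' cox_len_sref_conj_down(2,3)[OF w i' down]] sref_conj_sref_conj .
      qed (use i in auto)
    qed
  qed
qed

section \<open>Hecke relations on the involution module\<close>

lemma K_subspace_equalizer:
  assumes F: "\<And>a b f g. F (lincomb a f b g) = lincomb a (F f) b (F g)"
    and G: "\<And>a b f g. G (lincomb a f b g) = lincomb a (G f) b (G g)"
    and V: "K_subspace V"
  shows "K_subspace {x \<in> V. F x = (G x :: vec)}"
proof -
  \<comment> \<open>The zero vector is a combination with zero coefficients, so the two maps agree
    there.\<close>
  have "F (lincomb 0 f 0 f) = G (lincomb 0 f 0 f)" for f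
    unfolding F G by (simp add: lincomb_def)
  then have "F (\<lambda>v. 0) = G (\<lambda>v. 0)"
    by (simp add: lincomb_def)
  then show ?thesis using V by (auto simp: K_subspace_def F G)
qed

lemma sref_conj_up_down:
  assumes w: "w \<in> invols n" and up: "w i < w (Suc i)" "\<not> (w i = i \<and> w (Suc i) = Suc i)"
  shows "sref_conj i w (Suc i) < sref_conj i w i" "sref_conj i w i \<noteq> Suc i"
proof -
  have ne: "{w i, w (Suc i)} \<noteq> {i, Suc i}" using up by (auto simp: doubleton_eq_iff)
  show "sref_conj i w (Suc i) < sref_conj i w i" using up by (simp add: sref_less_iff[OF ne])
  show "sref_conj i w i \<noteq> Suc i"
    using up invols_eq_swap[OF w, of i "Suc i"] by (auto simp: sref_eq_swap)
qed

text \<open>Applying the operator once more to the relation shows that its solution set is stable,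
  which leaves the basis vectors with an ascent at \<open>i\<close>. Such a vector and its partner
  span a stable plane.\<close>

lemma M_Ts_quadratic:
  assumes i: "i \<in> {1..<n}" and m: "m \<in> Mvec n"
  shows "M_Ts n i (M_Ts n i m) = lincomb (uu^2 - 1) (M_Ts n i m) (uu^2) m"
proof -
  let ?T = "M_Ts n i"
  let ?U = "{x \<in> Mvec n. ?T (?T x) = lincomb (uu^2 - 1) (?T x) (uu^2) x}"
  have "Mvec n \<subseteq> ?U"
  proof (rule Mvec_subset_generated[where I = "{i}"])
    show "K_subspace ?U"
      by (rule K_subspace_equalizer[OF _ _ K_subspace_Mvec])
        (simp_all add: M_Ts_lincomb, simp add: lincomb_def algebra_simps)
    show "M_Ts n j x \<in> ?U" if "j \<in> {i}" "x \<in> ?U" for j x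
      using that i by (simp add: M_Ts_Mvec M_Ts_lincomb)
    show "bas w \<in> ?U" if w: "w \<in> invols n" and asc: "\<And>j. j \<in> {i} \<Longrightarrow> w j < w (Suc j)" for w
    proof (cases "w i = i \<and> w (Suc i) = Suc i")
      case True
      let ?v = "sref i \<circ> w"
      have v: "?v \<in> invols n" using True by (intro sref_comp_invols i w) auto
      have Tv: "?T (bas ?v) = lincomb (uu^2 - uu - 1) (bas ?v) (uu^2 - uu) (bas w)"
        using M_Ts_basis_swap[OF v i] True unfolding M_Ts_bas[OF v] by simp
      have Tw: "?T (bas w) = lincomb uu (bas w) (uu + 1) (bas ?v)"
        unfolding M_Ts_bas[OF w] using M_Ts_basis_fix[OF w i] True by simp
      \<comment> \<open>On the plane spanned by the two vectors the operator has trace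
        \<open>uu^2 - 1\<close> and determinant \<open>- (uu^2)\<close>.\<close>
      have "?T (?T (bas w)) = lincomb (uu^2 - 1) (?T (bas w)) (uu^2) (bas w)"
        unfolding Tw M_Ts_lincomb Tv
        by (rule ext) (simp add: lincomb_def algebra_simps power2_eq_square)
      then show ?thesis using bas_Mvec[OF w] by simp
    next
      case False
      let ?v = "sref_conj i w"
      have v: "?v \<in> invols n" by (rule sref_conj_invols[OF i w])
      have up: "w i < w (Suc i)" using asc by simp
      have Tv: "?T (bas ?v) = lincomb (uu^2 - 1) (bas ?v) (uu^2) (bas w)"
        unfolding M_Ts_bas[OF v] M_Ts_basis_down[OF v i sref_conj_up_down[OF w up False]] sref_conj_sref_conj ..
      have Tw: "?T (bas w) = bas ?v"
        unfolding M_Ts_bas[OF w] by (rule M_Ts_basis_up[OF w i up False])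
      have "?T (?T (bas w)) = lincomb (uu^2 - 1) (?T (bas w)) (uu^2) (bas w)"
        unfolding Tw Tv ..
      then show ?thesis using bas_Mvec[OF w] by simp
    qed
  qed (use i in auto)
  then show ?thesis using m by blast
qed

section \<open>The commutation and braid relations\<close>

lemma M_Ts_bas_fix:
  assumes "w \<in> invols n" "i \<in> {1..<n}" "w i = i" "w (Suc i) = Suc i"
  shows "M_Ts n i (bas w) = lincomb uu (bas w) (uu + 1) (bas (sref i \<circ> w))"
  unfolding M_Ts_bas[OF assms(1)] by (rule M_Ts_basis_fix[OF assms])

lemma M_Ts_bas_up:
  assumes "w \<in> invols n" "i \<in> {1..<n}" "w i < w (Suc i)" "\<not> (w i = i \<and> w (Suc i) = Suc i)"
  shows "M_Ts n i (bas w) = bas (sref_conj i w)"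
  unfolding M_Ts_bas[OF assms(1)] by (rule M_Ts_basis_up[OF assms])

lemma M_Ts_bas_down:
  assumes "w \<in> invols n" "i \<in> {1..<n}" "w (Suc i) < w i" "w i \<noteq> Suc i"
  shows "M_Ts n i (bas w) = lincomb (uu^2 - 1) (bas w) (uu^2) (bas (sref_conj i w))"
  unfolding M_Ts_bas[OF assms(1)] by (rule M_Ts_basis_down[OF assms])

lemma sref_commute_apply:
  assumes "Suc i < j \<or> Suc j < i"
  shows "sref i (sref j a) = sref j (sref i a)"
  using assms fun_cong[OF sref_commute[of i j id], of a] fun_cong[OF sref_commute[of j i id], of a]
  by auto

text \<open>\<open>far\<close> is symmetric in \<open>i\<close> and \<open>j\<close>, so both mixed
  cases of the commutation relation are covered.\<close>

lemma M_Ts_commute_fix_up: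
  assumes i: "i \<in> {1..<n}" and j: "j \<in> {1..<n}" and far: "Suc i < j \<or> Suc j < i"
    and w: "w \<in> invols n" and fixed: "w i = i" "w (Suc i) = Suc i"
    and up: "w j < w (Suc j)" "\<not> (w j = j \<and> w (Suc j) = Suc j)"
  shows "M_Ts n i (M_Ts n j (bas w)) = M_Ts n j (M_Ts n i (bas w))"
proof -
  \<comment> \<open>\<open>i\<close> and \<open>Suc i\<close> are fixed by \<open>w\<close>, hence
    are not values of \<open>w\<close> at \<open>j\<close> or \<open>Suc j\<close>.\<close>
  have out: "w j \<noteq> i" "w j \<noteq> Suc i" "w (Suc j) \<noteq> i" "w (Suc j) \<noteq> Suc i"
    using invols_eq_iff[OF w, of j i] invols_eq_iff[OF w, of j "Suc i"]
      invols_eq_iff[OF w, of "Suc j" i] invols_eq_iff[OF w, of "Suc j" "Suc i"] fixed far by auto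
  have s: "sref i \<circ> w \<in> invols n" using fixed by (intro sref_comp_invols i w) auto
  have c: "sref_conj j w \<in> invols n" by (rule sref_conj_invols[OF j w])
  have 1: "M_Ts n j (bas w) = bas (sref_conj j w)" by (rule M_Ts_bas_up[OF w j up])
  have 2: "M_Ts n i (bas (sref_conj j w)) = lincomb uu (bas (sref_conj j w)) (uu + 1) (bas (sref i \<circ> sref_conj j w))"
    using fixed far by (intro M_Ts_bas_fix c i) auto
  have 3: "M_Ts n j (bas (sref i \<circ> w)) = bas (sref_conj j (sref i \<circ> w))"
    using up out by (intro M_Ts_bas_up s j) auto
  have 4: "sref_conj j (sref i \<circ> w) = sref i \<circ> sref_conj j w"
    by (rule ext) (simp add: sref_commute_apply[OF far])
  show ?thesis unfolding 1 2 M_Ts_bas_fix[OF w i fixed] M_Ts_lincomb 3 4 ..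
qed

text \<open>By the quadratic relations the vectors on which the operators commute form a stable set,
  so only involutions ascending at both \<open>i\<close> and \<open>j\<close> remain.\<close>

lemma M_Ts_commute:
  assumes i: "i \<in> {1..<n}" and j: "j \<in> {1..<n}" and far: "Suc i < j" and m: "m \<in> Mvec n"
  shows "M_Ts n i (M_Ts n j m) = M_Ts n j (M_Ts n i m)"
proof -
  let ?S = "M_Ts n i" and ?T = "M_Ts n j"
  let ?U = "{x \<in> Mvec n. ?S (?T x) = ?T (?S x)}"
  note quad = M_Ts_quadratic[OF i] M_Ts_quadratic[OF j]
  note closed = M_Ts_Mvec[OF i] M_Ts_Mvec[OF j]
  have "Mvec n \<subseteq> ?U"
  proof (rule Mvec_subset_generated[where I = "{i, j}"])
    show "K_subspace ?U"
      by (rule K_subspace_equalizer[OF _ _ K_subspace_Mvec]) (simp_all add: M_Ts_lincomb)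
    show "M_Ts n k x \<in> ?U" if "k \<in> {i, j}" "x \<in> ?U" for k x
    proof -
      have x: "x \<in> Mvec n" and eq: "?S (?T x) = ?T (?S x)" using that by auto
      have "?S (?T (?S x)) = ?T (?S (?S x))"
        unfolding eq[symmetric] quad(1)[OF x] quad(1)[OF closed(2)] M_Ts_lincomb ..
      moreover have "?S (?T (?T x)) = ?T (?S (?T x))"
        unfolding eq quad(2)[OF x] quad(2)[OF closed(1)] M_Ts_lincomb ..
      ultimately show ?thesis using that(1) closed by auto
    qed
    show "bas w \<in> ?U" if w: "w \<in> invols n" and asc: "\<And>k. k \<in> {i, j} \<Longrightarrow> w k < w (Suc k)" for w
    proof -
      have ui: "w i < w (Suc i)" and uj: "w j < w (Suc j)" using asc by auto
      have "?S (?T (bas w)) = ?T (?S (bas w))"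
      proof (cases "w i = i \<and> w (Suc i) = Suc i")
        case fi: True
        show ?thesis
        proof (cases "w j = j \<and> w (Suc j) = Suc j")
          case fj: True
          have si: "sref i \<circ> w \<in> invols n" and sj: "sref j \<circ> w \<in> invols n"
            using fi fj by (auto intro: sref_comp_invols i j w)
          have 1: "?S (bas w) = lincomb uu (bas w) (uu + 1) (bas (sref i \<circ> w))"
            using fi by (intro M_Ts_bas_fix w i) auto
          have 2: "?T (bas w) = lincomb uu (bas w) (uu + 1) (bas (sref j \<circ> w))"
            using fj by (intro M_Ts_bas_fix w j) auto
          have 3: "?S (bas (sref j \<circ> w)) = lincomb uu (bas (sref j \<circ> w)) (uu + 1) (bas (sref i \<circ> (sref j \<circ> w)))"
            using fi far by (intro M_Ts_bas_fix sj i) auto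
          have 4: "?T (bas (sref i \<circ> w)) = lincomb uu (bas (sref i \<circ> w)) (uu + 1) (bas (sref i \<circ> (sref j \<circ> w)))"
            unfolding sref_commute[OF far] using fj far by (intro M_Ts_bas_fix si j) auto
          show ?thesis unfolding 1 2 M_Ts_lincomb 3 4 unfolding 1 2
            by (rule ext) (simp add: lincomb_def algebra_simps)
        next
          case False
          then show ?thesis using M_Ts_commute_fix_up[OF i j _ w] fi far uj by auto
        qed
      next
        case fi: False
        show ?thesis
        proof (cases "w j = j \<and> w (Suc j) = Suc j")
          case True
          then show ?thesis using M_Ts_commute_fix_up[OF j i _ w] fi far ui by auto
        next
          case fj: False
          have ci: "sref_conj i w \<in> invols n" and cjj: "sref_conj j w \<in> invols n"
            by (auto intro: sref_conj_invols i j w)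
          have 1: "?S (bas w) = bas (sref_conj i w)" by (rule M_Ts_bas_up[OF w i ui fi])
          have 2: "?T (bas w) = bas (sref_conj j w)" by (rule M_Ts_bas_up[OF w j uj fj])
          show ?thesis
          proof (cases "w i = j \<and> w (Suc i) = Suc j")
            case True
            then have wj: "w j = i" "w (Suc j) = Suc i" using invols_eq_swap[OF w] by auto
            \<comment> \<open>Here \<open>w\<close> exchanges the pairs \<open>i\<close>,
              \<open>Suc i\<close> and \<open>j\<close>, \<open>Suc j\<close> in order, so both
              conjugates coincide and are descents for the other reflection.\<close>
            have eq: "sref_conj j w = sref_conj i w"
            proof
              fix a
              show "sref_conj j w a = sref_conj i w a"
              proof (cases "a \<in> {i, Suc i, j, Suc j}")
                case T: True
                then show ?thesis using True wj far by auto
              next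
                case False
                then have "w a \<notin> {i, Suc i, j, Suc j}"
                  using True wj invols_eq_swap[OF w, of a i] invols_eq_swap[OF w, of a "Suc i"]
                    invols_eq_swap[OF w, of a j] invols_eq_swap[OF w, of a "Suc j"] by auto
                then show ?thesis using False by auto
              qed
            qed
            have 3: "?S (bas (sref_conj i w)) = lincomb (uu^2 - 1) (bas (sref_conj i w)) (uu^2) (bas (sref_conj i (sref_conj i w)))"
              using True far by (intro M_Ts_bas_down ci i) auto
            have 4: "?T (bas (sref_conj j w)) = lincomb (uu^2 - 1) (bas (sref_conj j w)) (uu^2) (bas (sref_conj j (sref_conj j w)))"
              using wj far by (intro M_Ts_bas_down cjj j) auto
            show ?thesis using 3 4 unfolding 1 2 eq[symmetric] sref_conj_sref_conj unfolding eq sref_conj_sref_conj by simp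
          next
            case False
            \<comment> \<open>The ascent \<open>ui\<close> also excludes the exchange in reversed
              order, so conjugation by one reflection preserves the ascent at the other.\<close>
            have ne: "{w i, w (Suc i)} \<noteq> {j, Suc j}" using False ui by (auto simp: doubleton_eq_iff)
            have ne': "{w j, w (Suc j)} \<noteq> {i, Suc i}"
              using False uj invols_eq_swap[OF w, of j i] invols_eq_swap[OF w, of "Suc j" "Suc i"]
              by (auto simp: doubleton_eq_iff)
            have 3: "?S (bas (sref_conj j w)) = bas (sref_conj i (sref_conj j w))"
            proof (rule M_Ts_bas_up[OF cjj i])
              show "sref_conj j w i < sref_conj j w (Suc i)" using ui far sref_less_iff[OF ne] by auto
              show "\<not> (sref_conj j w i = i \<and> sref_conj j w (Suc i) = Suc i)" using fi far by (auto simp: sref_eq_swap)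
            qed
            have 4: "?T (bas (sref_conj i w)) = bas (sref_conj j (sref_conj i w))"
            proof (rule M_Ts_bas_up[OF ci j])
              show "sref_conj i w j < sref_conj i w (Suc j)" using uj far sref_less_iff[OF ne'] by auto
              show "\<not> (sref_conj i w j = j \<and> sref_conj i w (Suc j) = Suc j)" using fj far by (auto simp: sref_eq_swap)
            qed
            have "sref_conj i (sref_conj j w) = sref_conj j (sref_conj i w)"
              using sref_commute[OF far, of id] by (simp add: fun_eq_iff)
            then show ?thesis unfolding 1 2 3 4 by simp
          qed
        qed
      qed
      then show ?thesis using bas_Mvec[OF w] by simp
    qed
  qed (use i j in auto)
  then show ?thesis using m by blast
qed

lemma sref_mono: "a < b \<Longrightarrow> \<not> (a = i \<and> b = Suc i) \<Longrightarrow> sref i a < sref i b"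
  by (subst sref_less_iff) (auto simp: doubleton_eq_iff)

lemma M_Ts_braid:
  assumes i: "i \<in> {1..<n}" and j: "Suc i \<in> {1..<n}" and m: "m \<in> Mvec n"
  shows "M_Ts n i (M_Ts n (Suc i) (M_Ts n i m)) = M_Ts n (Suc i) (M_Ts n i (M_Ts n (Suc i) m))"
proof -
  define j k where "j = Suc i" and "k = Suc j"
  note jk = j_def k_def
  have j: "j \<in> {1..<n}" using assms(2) by (simp add: jk)
  let ?S = "M_Ts n i" and ?T = "M_Ts n j"
  let ?U = "{x \<in> Mvec n. ?S (?T (?S x)) = ?T (?S (?T x))}"
  note quad = M_Ts_quadratic[OF i] M_Ts_quadratic[OF j]
  note closed = M_Ts_Mvec[OF i] M_Ts_Mvec[OF j]
  have "Mvec n \<subseteq> ?U"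
  proof (rule Mvec_subset_generated[where I = "{i, j}"])
    show "K_subspace ?U"
      by (rule K_subspace_equalizer[OF _ _ K_subspace_Mvec]) (simp_all add: M_Ts_lincomb)
    show "M_Ts n l x \<in> ?U" if "l \<in> {i, j}" "x \<in> ?U" for l x
    proof -
      have x: "x \<in> Mvec n" and eq: "?S (?T (?S x)) = ?T (?S (?T x))" using that by auto
      \<comment> \<open>After \<open>eq\<close>, the squares on the two sides expand to the same
        combination of \<open>?T (?S (?T x))\<close> and \<open>?S (?T x)\<close>.\<close>
      have "?S (?T (?S (?S x))) = ?T (?S (?T (?S x)))"
        unfolding eq quad(1)[OF x] quad(2)[OF closed(1)] M_Ts_lincomb ..
      moreover have "?S (?T (?S (?T x))) = ?T (?S (?T (?T x)))"
        unfolding eq[symmetric] quad(2)[OF x] quad(1)[OF closed(2)] M_Ts_lincomb ..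
      ultimately show ?thesis using that(1) closed by auto
    qed
    show "bas w \<in> ?U" if w: "w \<in> invols n" and asc: "\<And>k. k \<in> {i, j} \<Longrightarrow> w k < w (Suc k)" for w
    proof -
      have ij: "w i < w j" and jk': "w j < w k" using asc by (auto simp: jk)
      \<comment> \<open>An involution mapping one of the three points to another swaps them, against
        the increasing order.\<close>
      have out: "w i \<noteq> j" "w i \<noteq> k" "w j \<noteq> i" "w j \<noteq> k" "w k \<noteq> i" "w k \<noteq> j"
        using ij jk' invols_eq_swap[OF w, of i j] invols_eq_swap[OF w, of j k] invols_eq_swap[OF w, of i k]
        by (auto simp: jk)
      have sval: "sref i i = j" "sref i j = i" "sref i k = k" "sref j i = i" "sref j j = k" "sref j k = j"
        by (auto simp: jk)
      have Sucs: "Suc i = j" "Suc j = k" by (simp_all add: jk)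
      have ne: "i < j" "j < k" "i < k" by (simp_all add: jk)
      have ci: "sref_conj i v \<in> invols n" if "v \<in> invols n" for v by (rule sref_conj_invols[OF i that])
      have cjj: "sref_conj j v \<in> invols n" if "v \<in> invols n" for v by (rule sref_conj_invols[OF j that])
      have br: "sref i (sref j (sref i a)) = sref j (sref i (sref j a))" for a
        using fun_cong[OF sref_braid[of i id], of a] by (simp add: jk)
      have cbr: "sref_conj i (sref_conj j (sref_conj i v)) = sref_conj j (sref_conj i (sref_conj j v))" for v
        by (rule ext) (simp add: br)
      note fixi = M_Ts_bas_fix[OF _ i, unfolded Sucs] and fixj = M_Ts_bas_fix[OF _ j, unfolded Sucs]
      note upi = M_Ts_bas_up[OF _ i, unfolded Sucs] and upj = M_Ts_bas_up[OF _ j, unfolded Sucs]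
      note downi = M_Ts_bas_down[OF _ i, unfolded Sucs] and downj = M_Ts_bas_down[OF _ j, unfolded Sucs]
      note srefi = sref_comp_invols[OF i, unfolded Sucs] and srefj = sref_comp_invols[OF j, unfolded Sucs]
      have lti: "sref i a < sref i b" if "a < b" "a = i \<Longrightarrow> b \<noteq> j" for a b
        using that by (intro sref_mono) (auto simp: jk)
      have ltj: "sref j a < sref j b" if "a < b" "a = j \<Longrightarrow> b \<noteq> k" for a b
        using that by (intro sref_mono) (auto simp: jk)
      have "?S (?T (?S (bas w))) = ?T (?S (?T (bas w)))"
      proof -
        have ge: "w i = i \<or> w i < i" if "w j = j" using that ij ne out by (auto simp: jk)
        have le: "w k = k \<or> k < w k" if "w j = j" using that jk' ne out by (auto simp: jk)
        \<comment> \<open>If \<open>j\<close> is fixed, monotonicity forces w i <= i and k <= w k;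
          the cases record where equality holds. Two strict inequalities fall under
          \<open>gen\<close>.\<close>
        consider (all) "w i = i" "w j = j" "w k = k" | (ij) "w i = i" "w j = j" "k < w k"
          | (jk) "w i < i" "w j = j" "w k = k"
          | (gen) "\<not> (w i = i \<and> w j = j)" "\<not> (w j = j \<and> w k = k)"
          using ge le by blast
        then show ?thesis
        proof cases
          case all
          let ?s = "sref i \<circ> w" and ?t = "sref j \<circ> w"
          \<comment> \<open>\<open>p\<close> is \<open>w\<close> times the transposition of
            \<open>i\<close> and \<open>k\<close>, reached from \<open>?s\<close> through
            \<open>j\<close> and from \<open>?t\<close> through \<open>i\<close>.\<close>
          define p where "p = sref_conj j ?s"
          have s: "?s \<in> invols n" and t: "?t \<in> invols n" using all w by (auto intro: srefi srefj)
          have p: "p \<in> invols n" unfolding p_def by (rule cjj[OF s])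
          have comm: "w (sref i a) = sref i (w a)" "w (sref j a) = sref j (w a)" for a
            using all fun_cong[OF sref_comm_iff[OF w, of i, THEN iffD2], of a]
              fun_cong[OF sref_comm_iff[OF w, of j, THEN iffD2], of a] by (auto simp: Sucs)
          have p': "p = sref_conj i ?t" by (rule ext) (simp add: p_def comm br)
          have 1: "?S (bas w) = lincomb uu (bas w) (uu + 1) (bas ?s)" using all by (intro fixi w)
          have 2: "?T (bas w) = lincomb uu (bas w) (uu + 1) (bas ?t)" using all by (intro fixj w)
          have 3: "?T (bas ?s) = bas p" unfolding p_def using all ne by (intro upj s) (auto simp: sval Sucs)
          have 4: "?S (bas ?t) = bas p" unfolding p' using all ne by (intro upi t) (auto simp: sval Sucs)
          have 5: "?S (bas p) = lincomb (uu^2 - 1) (bas p) (uu^2) (bas (sref_conj i p))"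
            using all ne by (intro downi p) (auto simp: p_def sval Sucs)
          have 6: "?T (bas p) = lincomb (uu^2 - 1) (bas p) (uu^2) (bas (sref_conj j p))"
            using all ne by (intro downj p) (auto simp: p_def sval Sucs)
          have 7: "sref_conj i p = ?t" "sref_conj j p = ?s" unfolding p' sref_conj_sref_conj unfolding p'[symmetric] p_def sref_conj_sref_conj by auto
          show ?thesis
            unfolding 1 2 M_Ts_lincomb 3 4 unfolding 1 2 M_Ts_lincomb 3 4 5 6 7
            by (rule ext) (simp add: lincomb_def algebra_simps power2_eq_square)
        next
          case ij
          let ?s = "sref i \<circ> w"
          have s: "?s \<in> invols n" using ij w by (auto intro: srefi)
          have wk: "sref i (w k) = w k" "sref j (w k) = w k" using ij(3) by (auto simp: jk)
          have 1: "?S (bas w) = lincomb uu (bas w) (uu + 1) (bas ?s)" using ij by (intro fixi w)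
          have 2: "?T (bas w) = bas (sref_conj j w)" using ij ne by (intro upj w) auto
          have 3: "?T (bas ?s) = bas (sref_conj j ?s)" using ij ne wk by (intro upj s) (auto simp: sval Sucs)
          have 4: "?S (bas (sref_conj j w)) = bas (sref_conj i (sref_conj j w))"
            using ij wk ne by (intro upi cjj w) (auto simp: sval Sucs)
          have 5: "?S (bas (sref_conj j ?s)) = bas (sref_conj i (sref_conj j ?s))"
            using ij wk ne by (intro upi cjj s) (auto simp: sval Sucs)
          \<comment> \<open>The two conjugations move the fixed points \<open>i\<close>,
            \<open>j\<close> to \<open>j\<close>, \<open>k\<close>, so the last operator meets a
            commuting ascent again.\<close>
          have 6: "?T (bas (sref_conj i (sref_conj j w))) =
              lincomb uu (bas (sref_conj i (sref_conj j w))) (uu + 1) (bas (sref j \<circ> sref_conj i (sref_conj j w)))"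
            using ij by (intro fixj ci cjj w) (auto simp: sval Sucs)
          have 7: "sref j \<circ> sref_conj i (sref_conj j w) = sref_conj i (sref_conj j ?s)" by (rule ext) (simp add: br)
          show ?thesis unfolding 1 2 M_Ts_lincomb 3 4 5 6 7 ..
        next
          case jk
          let ?t = "sref j \<circ> w"
          have t: "?t \<in> invols n" using jk w by (auto intro: srefj)
          have wi: "sref i (w i) = w i" "sref j (w i) = w i" using jk(1) by (auto simp: j_def k_def)
          have 1: "?T (bas w) = lincomb uu (bas w) (uu + 1) (bas ?t)" using jk by (intro fixj w)
          have 2: "?S (bas w) = bas (sref_conj i w)" using jk ne by (intro upi w) auto
          have 3: "?S (bas ?t) = bas (sref_conj i ?t)"
            using jk ne wi by (intro upi t) (auto simp: sval Sucs)
          have 4: "?T (bas (sref_conj i w)) = bas (sref_conj j (sref_conj i w))"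
            using jk wi ne by (intro upj ci w) (auto simp: sval Sucs)
          have 5: "?T (bas (sref_conj i ?t)) = bas (sref_conj j (sref_conj i ?t))"
            using jk wi ne by (intro upj ci t) (auto simp: sval Sucs)
          \<comment> \<open>The mirror image: the fixed points \<open>j\<close>, \<open>k\<close>
            have moved to \<open>i\<close>, \<open>j\<close>.\<close>
          have 6: "?S (bas (sref_conj j (sref_conj i w))) =
              lincomb uu (bas (sref_conj j (sref_conj i w))) (uu + 1) (bas (sref i \<circ> sref_conj j (sref_conj i w)))"
            using jk by (intro fixi ci cjj w) (auto simp: sval Sucs)
          have 7: "sref i \<circ> sref_conj j (sref_conj i w) = sref_conj j (sref_conj i ?t)" by (rule ext) (simp add: br)
          show ?thesis unfolding 1 2 M_Ts_lincomb 3 4 5 6 7 ..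
        next
          case gen
          \<comment> \<open>With \<open>i\<close> and \<open>k\<close> fixed, \<open>w j\<close>
            would lie strictly between them and be \<open>j\<close>. So at most one point is fixed,
            every step is a length-raising conjugation, and both sides conjugate by the longest
            element.\<close>
          have not_ik: "\<not> (w i = i \<and> w k = k)" using gen ij jk' Sucs by auto
          have ik: "w i < w k" using ij jk' by simp
          have 1: "?S (bas w) = bas (sref_conj i w)" using ij gen by (intro upi w)
          have 2: "?T (bas (sref_conj i w)) = bas (sref_conj j (sref_conj i w))"
            using ik out not_ik by (intro upj ci w) (auto simp: sval Sucs sref_eq_swap simp del: sref_simps(3) intro!: lti)
          have 3: "?S (bas (sref_conj j (sref_conj i w))) = bas (sref_conj i (sref_conj j (sref_conj i w)))"
            using jk' out gen by (intro upi ci cjj w) (auto simp: sval Sucs sref_eq_swap simp del: sref_simps(3) intro!: lti ltj)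
          have 4: "?T (bas w) = bas (sref_conj j w)" using jk' gen by (intro upj w)
          have 5: "?S (bas (sref_conj j w)) = bas (sref_conj i (sref_conj j w))"
            using ik out not_ik by (intro upi cjj w) (auto simp: sval Sucs sref_eq_swap simp del: sref_simps(3) intro!: ltj)
          have 6: "?T (bas (sref_conj i (sref_conj j w))) = bas (sref_conj j (sref_conj i (sref_conj j w)))"
            using ij out gen by (intro upj ci cjj w) (auto simp: sval Sucs sref_eq_swap simp del: sref_simps(3) intro!: lti ltj)
          show ?thesis unfolding 1 2 3 4 5 6 cbr ..
        qed
      qed
      then show ?thesis using bas_Mvec[OF w] by simp
    qed
  qed (use i j in auto)
  then show ?thesis using m unfolding j_def by blast
qed

section \<open>The basis operators on the involution module\<close>

lemma M_Tw_act_word: "M_Tw n w = act_word (M_Ts n) (reduced_word n w)"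
  by (simp add: M_Tw_def act_word_def)

text \<open>Matsumoto's theorem on \<open>Mvec n\<close> frees \<open>M_Tw\<close> from the chosen
  reduced word.\<close>

lemma M_Tw_word_perm:
  assumes "is_reduced n is" "m \<in> Mvec n"
  shows "M_Tw n (word_perm is) m = act_word (M_Ts n) is m"
  unfolding M_Tw_act_word
proof (rule act_word_reduced_unique)
  show "word_perm (reduced_word n (word_perm is)) = word_perm is"
    "is_reduced n (reduced_word n (word_perm is))"
    using reduced_word[OF is_reducedD(3)[OF assms(1)]] by auto
qed (use assms M_Ts_Mvec M_Ts_commute M_Ts_braid in auto)

lemma act_word_M_Ts_Mvec: "simple_word n is \<Longrightarrow> m \<in> Mvec n \<Longrightarrow> act_word (M_Ts n) is m \<in> Mvec n"
  by (cases "is") (auto simp: M_Ts_Mvec)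

lemma M_Tw_Mvec: "w \<in> perms n \<Longrightarrow> m \<in> Mvec n \<Longrightarrow> M_Tw n w m \<in> Mvec n"
  unfolding M_Tw_act_word by (intro act_word_M_Ts_Mvec is_reducedD(1) reduced_word)

lemma M_Tw_lincomb: "M_Tw n w (lincomb a f b g) = lincomb a (M_Tw n w f) b (M_Tw n w g)"
proof -
  have "act_word (M_Ts n) is (lincomb a f b g) = lincomb a (act_word (M_Ts n) is f) b (act_word (M_Ts n) is g)" for "is"
    by (induction "is") (simp_all add: M_Ts_lincomb)
  then show ?thesis by (simp add: M_Tw_act_word)
qed

lemma M_Tw_id: "M_Tw n id m = m"
  using reduced_word[OF id_perms, of n] by (simp add: M_Tw_act_word is_reduced_def)

lemma M_Ts_M_Tw_up:
  assumes w: "w \<in> perms n" and i: "i \<in> {1..<n}" and up: "inv w i < inv w (Suc i)" and m: "m \<in> Mvec n"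
  shows "M_Ts n i (M_Tw n w m) = M_Tw n (sref i \<circ> w) m"
proof -
  have "is_reduced n (i # reduced_word n w)"
    using reduced_word[OF w] i up by (simp add: is_reduced_Cons_iff)
  from M_Tw_word_perm[OF this m] show ?thesis
    unfolding word_perm_simps reduced_word(2)[OF w] by (simp add: M_Tw_act_word)
qed

lemma M_Ts_M_Tw_down:
  assumes w: "w \<in> perms n" and i: "i \<in> {1..<n}" and down: "inv w (Suc i) < inv w i" and m: "m \<in> Mvec n"
  shows "M_Ts n i (M_Tw n w m) = lincomb (uu^2 - 1) (M_Tw n w m) (uu^2) (M_Tw n (sref i \<circ> w) m)"
proof -
  let ?v = "sref i \<circ> w"
  have v: "?v \<in> perms n" by (intro sref_comp_perms i w)
  have "M_Ts n i (M_Tw n ?v m) = M_Tw n (sref i \<circ> ?v) m"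
    using down by (intro M_Ts_M_Tw_up v i m) (simp add: inv_sref_comp[OF w])
  then have "M_Tw n w m = M_Ts n i (M_Tw n ?v m)" by simp
  then show ?thesis using M_Ts_quadratic[OF i M_Tw_Mvec[OF v m]] by simp
qed

lemma cox_len_right_up:
  assumes w: "w \<in> perms n" and i: "i \<in> {1..<n}" and up: "w i < w (Suc i)"
  shows "cox_len n (w \<circ> sref i) = Suc (cox_len n w)"
proof -
  have "inv (w \<circ> sref i) = sref i \<circ> inv w" by (simp add: o_inv_distrib perms_bij[OF w])
  then have "cox_len n (w \<circ> sref i) = cox_len n (sref i \<circ> inv w)"
    using cox_len_inv[OF sref_comp_perms(2)[OF i w]] by simp
  also have "\<dots> = Suc (cox_len n (inv w))"
    using up by (intro cox_len_up perms_inv w i) (simp add: inv_inv_eq perms_bij[OF w])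
  finally show ?thesis by (simp add: cox_len_inv[OF w])
qed

text \<open>By the ascent, a reduced word stays reduced when \<open>i\<close> is appended, and the
  last letter acts first.\<close>

lemma M_Tw_right:
  assumes w: "w \<in> perms n" and i: "i \<in> {1..<n}" and up: "w i < w (Suc i)" and m: "m \<in> Mvec n"
  shows "M_Tw n (w \<circ> sref i) m = M_Tw n w (M_Ts n i m)"
proof -
  let ?is = "reduced_word n w @ [i]"
  have wp: "word_perm ?is = w \<circ> sref i"
    by (simp add: word_perm_append reduced_word(2)[OF w])
  have "is_reduced n ?is"
    unfolding is_reduced_def wp cox_len_right_up[OF w i up]
    using reduced_word[OF w] i by (auto simp: is_reduced_def)
  from M_Tw_word_perm[OF this m] show ?thesis
    unfolding wp by (simp add: act_word_append M_Tw_act_word)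
qed

section \<open>The coefficient of a_1 in T_w a_1\<close>

lemma reduced_letters_less:
  "is_reduced n is \<Longrightarrow> (\<And>a. m \<le> a \<Longrightarrow> word_perm is a = a) \<Longrightarrow> i \<in> set is \<Longrightarrow> Suc i < m"
proof (induction "is")
  case (Cons j "is")
  define w where "w = word_perm (j # is)"
  have w: "w \<in> perms n" unfolding w_def by (rule is_reducedD(3)[OF Cons.prems(1)])
  have fixed: "w a = a" if "m \<le> a" for a using Cons.prems(2) that by (simp add: w_def)
  have inv_fixed: "inv w a = a" if "m \<le> a" for a
    using fixed[OF that] by (metis bij_inv_eq_iff perms_bij[OF w])
  have d: "inv w (Suc j) < inv w j" unfolding w_def by (rule is_reduced_Cons_descent[OF Cons.prems(1)])
  \<comment> \<open>Otherwise \<open>Suc j\<close> is fixed, so the descent makes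
    \<open>inv w j\<close> exceed it. Then \<open>w\<close> fixes \<open>inv w j\<close> as well,
    although it sends it to \<open>j\<close>.\<close>
  have j: "Suc j < m"
  proof (rule ccontr)
    assume "\<not> Suc j < m"
    then have "Suc j < inv w j" "m \<le> Suc j" using d inv_fixed[of "Suc j"] by auto
    then have "w (inv w j) = inv w j" using fixed by simp
    moreover have "w (inv w j) = j" using perms_bij[OF w] by (simp add: bij_is_surj surj_f_inv_f)
    ultimately show False using \<open>Suc j < inv w j\<close> by simp
  qed
  have "word_perm is a = a" if "m \<le> a" for a
  proof -
    have "word_perm is a = sref j (w a)" by (simp add: w_def)
    then show ?thesis using fixed[OF that] that j by simp
  qed
  then show ?case using Cons.IH Cons.prems j by (auto simp: is_reduced_Cons_iff)
qed simp

lemma M_Ts_basis_support: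
  assumes "v \<noteq> w" "v \<noteq> sref i \<circ> w" "v \<noteq> sref i \<circ> w \<circ> sref i"
  shows "M_Ts_basis n i w v = 0"
proof -
  have "bas w v = 0" "bas (sref i \<circ> w) v = 0" "bas (sref i \<circ> w \<circ> sref i) v = 0"
    using assms by (auto simp: bas_def)
  then show ?thesis
    unfolding M_Ts_basis_def Let_def by (simp only: mult_zero_right add_0_right split: if_split) simp
qed

text \<open>As \<open>Suc i < m\<close>, the reflection leaves \<open>m\<close> alone, so a
  coefficient at an involution fixing \<open>m\<close> comes only from involutions fixing
  \<open>m\<close>.\<close>

lemma M_Ts_vanish_fixed:
  assumes i: "i \<in> {1..<n}" "Suc i < m" and f: "\<And>v. v \<in> invols n \<Longrightarrow> v m = m \<Longrightarrow> f v = 0"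
    and v: "v m = m"
  shows "M_Ts n i f v = 0"
  unfolding M_Ts_def
proof (rule sum.neutral, rule ballI)
  fix w assume w: "w \<in> invols n"
  show "f w * M_Ts_basis n i w v = 0"
  proof (cases "w m = m")
    case True
    then show ?thesis using f w by simp
  next
    case False
    have "v \<noteq> w" "v \<noteq> sref i \<circ> w" "v \<noteq> sref i \<circ> w \<circ> sref i"
      using False v i(2) by (auto simp: sref_eq_swap dest!: fun_cong[of v _ m])
    then show ?thesis by (simp add: M_Ts_basis_support)
  qed
qed

lemma M_Tw_vanish_fixed:
  assumes w: "w \<in> perms n" "\<And>a. m \<le> a \<Longrightarrow> w a = a"
    and f: "\<And>v. v m = m \<Longrightarrow> f v = 0" and v: "v m = m"
  shows "M_Tw n w f v = 0"
proof -
  have "act_word (M_Ts n) is f v = 0" if "simple_word n is" "\<forall>i\<in>set is. Suc i < m" "v m = m" for "is" v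
    using that by (induction "is" arbitrary: v) (auto simp: f intro!: M_Ts_vanish_fixed[where m = m])
  moreover have "\<forall>i\<in>set (reduced_word n w). Suc i < m"
    using reduced_letters_less[OF reduced_word(1)[OF w(1)]] w by (simp add: reduced_word(2)[OF w(1)])
  ultimately show ?thesis
    using v is_reducedD(1)[OF reduced_word(1)[OF w(1)]] by (simp add: M_Tw_act_word)
qed

lemma transpose_invols:
  assumes "j \<in> {1..n}" "k \<in> {1..n}"
  shows "transpose j k \<in> invols n"
  using permutes_swap_id[OF assms] by (simp add: invols_def perms_def)

text \<open>A value above \<open>m\<close> is a fixed point and is taken only at itself, whereas
  \<open>Suc k\<close> is at most \<open>m\<close>. This makes \<open>k\<close> a right descent of
  \<open>w\<close>.\<close>

lemma perms_below_max:
  assumes w: "w \<in> perms n" and fixed: "\<And>a. m < a \<Longrightarrow> w a = a" and k: "w k = m" "k < m"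
  shows "w (Suc k) < m"
proof (rule ccontr)
  assume "\<not> ?thesis"
  moreover have "w (Suc k) \<noteq> m" using perms_eq_iff[OF w, of "Suc k" k] k by auto
  ultimately have "m < w (Suc k)" by simp
  then have "w (w (Suc k)) = w (Suc k)" by (rule fixed)
  then show False using perms_eq_iff[OF w, of "w (Suc k)" "Suc k"] \<open>m < w (Suc k)\<close> k by simp
qed

text \<open>Peeling the letters \<open>k, k + 1, \<dots>, m - 1\<close> off the right end of \<open>w\<close> turns \<open>a\<^bsub>(j k)\<^esub>\<close> into \<open>a\<^bsub>(j m)\<^esub>\<close>,
  and the parabolic subgroup fixing \<open>m\<close> never gets from an involution moving \<open>m\<close> to one fixing \<open>m\<close>.\<close>

lemma M_Tw_transpose_coeff:
  assumes "w \<in> perms n" "\<And>a. m < a \<Longrightarrow> w a = a" "w k = m" "1 \<le> j" "j < k" "k \<le> m" "m \<le> n"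
  shows "M_Tw n w (bas (transpose j k)) id = 0"
  using assms
proof (induction "m - k" arbitrary: w k)
  case 0
  then have km: "k = m" by simp
  show ?case
  \<comment> \<open>Now \<open>w\<close> fixes \<open>m\<close> too, \<open>transpose j m\<close>
    moves \<open>m\<close>, and the target \<open>id\<close> fixes it.\<close>
  proof (rule M_Tw_vanish_fixed[where m = m])
    show "w a = a" if "m \<le> a" for a using 0 km that by (cases "a = m") auto
    show "bas (transpose j k) v = 0" if "v m = m" for v
      using that km \<open>j < k\<close> by (auto simp: bas_def)
  qed (use 0 in auto)
next
  case (Suc d)
  then have k: "k \<in> {1..<n}" and km: "k < m" by auto
  let ?v = "w \<circ> sref k"
  have v: "?v \<in> perms n" by (intro sref_comp_perms k Suc.prems)
  have up: "?v k < ?v (Suc k)" using perms_below_max[OF Suc.prems(1-3) km] Suc.prems by simp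
  have t: "transpose j k \<in> invols n" using Suc.prems by (intro transpose_invols) auto
  have "M_Tw n w (bas (transpose j k)) = M_Tw n ?v (M_Ts n k (bas (transpose j k)))"
    using M_Tw_right[OF v k up bas_Mvec[OF t]] unfolding sref_comp_sref(3) .
  also have "M_Ts n k (bas (transpose j k)) = bas (sref_conj k (transpose j k))"
    using \<open>j < k\<close> by (intro M_Ts_bas_up t k) auto
  also have "sref_conj k (transpose j k) = transpose j (Suc k)"
    using \<open>j < k\<close> by (intro ext) (auto simp: sref_def transpose_def)
  finally have "M_Tw n w (bas (transpose j k)) = M_Tw n ?v (bas (transpose j (Suc k)))" .
  moreover have "M_Tw n ?v (bas (transpose j (Suc k))) id = 0"
    using Suc.prems Suc.hyps(2) km by (intro Suc.hyps(1) v) auto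
  ultimately show ?case by simp
qed

text \<open>For the largest moved point \<open>m\<close> and \<open>w k = m\<close>, the right
  descent \<open>k\<close> turns a_1 into u a_1 + (u + 1) a_(s_k). The first term gives the
  induction on the length; the second contributes nothing.\<close>

lemma M_Tw_unit_coeff: "w \<in> perms n \<Longrightarrow> M_Tw n w (bas id) id = uu ^ cox_len n w"
proof (induction "cox_len n w" arbitrary: w rule: less_induct)
  case less
  note w = less.prems
  show ?case
  proof (cases "w = id")
    case True
    then show ?thesis by (simp add: M_Tw_id bas_def)
  next
    case False
    let ?A = "{a. w a \<noteq> a}"
    have sub: "?A \<subseteq> {1..n}" using w by (auto simp: perms_def permutes_def)
    then have fin: "finite ?A" by (rule finite_subset) simp
    have ne: "?A \<noteq> {}" using False by (auto simp: fun_eq_iff)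
    define m where "m = Max ?A"
    have "m \<in> ?A" unfolding m_def by (rule Max_in[OF fin ne])
    then have wm: "w m \<noteq> m" and mn: "m \<le> n" using sub by auto
    have fixed: "w a = a" if "m < a" for a
      using that Max_ge[OF fin, of a] unfolding m_def by auto
    obtain k where k: "w k = m" using perms_bij[OF w] by (metis bij_pointE)
    have km: "k < m" using k wm fixed[of k] by (metis linorder_neqE_nat)
    have "k \<in> ?A" using k km by simp
    then have k1: "k \<ge> 1" using sub by auto
    then have kn: "k \<in> {1..<n}" using km mn by simp
    let ?v = "w \<circ> sref k"
    have v: "?v \<in> perms n" by (intro sref_comp_perms kn w)
    have up: "?v k < ?v (Suc k)" using perms_below_max[OF w fixed k km] k by simp
    have len: "cox_len n w = Suc (cox_len n ?v)"
      using cox_len_right_up[OF v kn up] unfolding sref_comp_sref(3) .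
    have "M_Tw n w (bas id) = M_Tw n ?v (M_Ts n k (bas id))"
      using M_Tw_right[OF v kn up bas_Mvec[OF id_invols]] unfolding sref_comp_sref(3) .
    also have "M_Ts n k (bas id) = lincomb uu (bas id) (uu + 1) (bas (sref k))"
      using M_Ts_bas_fix[OF id_invols kn] by simp
    finally have "M_Tw n w (bas id) = M_Tw n ?v (lincomb uu (bas id) (uu + 1) (bas (sref k)))" .
    \<comment> \<open>\<open>?v\<close> sends \<open>Suc k\<close> to \<open>m\<close>, so the
      vanishing lemma applies to the transposition of \<open>k\<close> and
      \<open>Suc k\<close>.\<close>
    moreover have "M_Tw n ?v (bas (sref k)) id = 0"
      unfolding sref_def[of k] using fixed k km k1 mn by (intro M_Tw_transpose_coeff[where m = m] v[unfolded sref_def]) auto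
    then have "M_Tw n ?v (lincomb uu (bas id) (uu + 1) (bas (sref k))) id = uu * M_Tw n ?v (bas id) id"
      unfolding M_Tw_lincomb by (simp add: lincomb_def)
    ultimately show ?thesis using less.hyps[OF _ v] len by simp
  qed
qed

section \<open>The isomorphism\<close>

text \<open>For an involution this counts the 2-cycles, one element each.\<close>

definition exceedances :: "nat \<Rightarrow> perm \<Rightarrow> nat set" where
  "exceedances n w = {a \<in> {1..n}. a < w a}"

lemma card_exceedances_fix:
  assumes w: "w \<in> invols n" and i: "i \<in> {1..<n}" and fixed: "w i = i" "w (Suc i) = Suc i"
  shows "card (exceedances n (sref i \<circ> w)) = Suc (card (exceedances n w))"
proof -
  have "a < sref i (w a) \<longleftrightarrow> a = i \<or> a < w a" for a
    using fixed invols_eq_iff[OF w, of a i] invols_eq_iff[OF w, of a "Suc i"]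
    by (cases "a = i \<or> a = Suc i") auto
  then have "exceedances n (sref i \<circ> w) = insert i (exceedances n w)"
    using i by (auto simp: exceedances_def)
  then show ?thesis using fixed by (simp add: exceedances_def)
qed

text \<open>Conjugation carries 2-cycles to 2-cycles, and unless \<open>i\<close>,
  \<open>Suc i\<close> is one of them, \<open>sref i\<close> keeps the smaller element
  smaller.\<close>

lemma card_exceedances_sref_conj:
  assumes i: "i \<in> {1..<n}" and w: "w \<in> invols n" and ne: "w i \<noteq> Suc i"
  shows "card (exceedances n (sref_conj i w)) = card (exceedances n w)"
proof -
  have *: "sref i b < sref i (w b) \<longleftrightarrow> b < w b" for b
    using ne invols_eq_swap[OF w, of i "Suc i"] by (intro sref_less_iff) (auto simp: doubleton_eq_iff)
  have s: "sref i c \<in> {1..n} \<longleftrightarrow> c \<in> {1..n}" for c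
    using perms_in[OF sref_perms[OF i]] by blast
  have "exceedances n (sref_conj i w) = sref i ` exceedances n w"
  proof (intro set_eqI)
    fix a
    have "a \<in> exceedances n (sref_conj i w) \<longleftrightarrow> sref i a \<in> exceedances n w"
      using *[of "sref i a"] s[of a] by (auto simp: exceedances_def)
    also have "\<dots> \<longleftrightarrow> a \<in> sref i ` exceedances n w" by (metis image_iff sref_sref)
    finally show "a \<in> exceedances n (sref_conj i w) \<longleftrightarrow> a \<in> sref i ` exceedances n w" .
  qed
  then show ?thesis by (simp add: card_image inj_on_def)
qed

text \<open>The ratio along a commuting ascent, where length and number of 2-cycles grow by one, is
  (u^2 - u) / (u + 1); along a conjugation, where the length grows by two, it is u^2. These are the
  quotients of the opposite matrix entries of T_s.\<close>

definition weight :: "nat \<Rightarrow> perm \<Rightarrow> K" where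
  "weight n w = uu ^ cox_len n w * ((uu - 1) / (uu + 1)) ^ card (exceedances n w)"

definition form :: "nat \<Rightarrow> vec \<Rightarrow> vec \<Rightarrow> K" where
  "form n f g = (\<Sum>w\<in>invols n. weight n w * f w * g w)"

lemma weight_nonzero: "weight n w \<noteq> 0"
  using uu_nonzero(3) by (simp add: weight_def del: uu_nonzero(3))

lemma weight_id: "weight n id = 1"
  by (simp add: weight_def exceedances_def)

lemma weight_M_Ts_basis_up:
  assumes w: "w \<in> invols n" and i: "i \<in> {1..<n}" and up: "w i < w (Suc i)"
    and v: "v \<noteq> w" "v = sref i \<circ> w \<and> sref i \<circ> w = w \<circ> sref i \<or> v = sref_conj i w \<and> sref i \<circ> w \<noteq> w \<circ> sref i"
  shows "weight n v * M_Ts_basis n i w v = weight n w * M_Ts_basis n i v w"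
proof (cases "w i = i \<and> w (Suc i) = Suc i")
  case True
  then have fixed: "w i = i" "w (Suc i) = Suc i" by auto
  then have vs: "v = sref i \<circ> w" using v(2) sref_comm_iff[OF w, of i] by auto
  have vi: "v \<in> invols n" unfolding vs using True by (intro sref_comp_invols i w) auto
  have len: "cox_len n v = Suc (cox_len n w)"
    unfolding vs using up w by (intro cox_len_up i invols_perms[OF w]) simp
  have wt: "weight n v = weight n w * (uu * ((uu - 1) / (uu + 1)))"
    unfolding weight_def len using card_exceedances_fix[OF w i fixed] by (simp add: vs)
  have sv: "sref i \<circ> v = w" by (simp add: vs)
  have "M_Ts_basis n i w v = uu + 1"
    unfolding M_Ts_basis_fix[OF w i fixed] using v(1) by (simp add: lincomb_def bas_def vs)
  moreover have "M_Ts_basis n i v w = uu^2 - uu"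
    using M_Ts_basis_swap[OF vi i] v(1) unfolding sv by (simp add: lincomb_def bas_def vs fixed)
  ultimately show ?thesis
    using uu_nonzero(2) by (simp add: wt power2_eq_square right_diff_distrib)
next
  case False
  then have nc: "sref i \<circ> w \<noteq> w \<circ> sref i"
    using up invols_eq_swap[OF w, of i "Suc i"] by (auto simp: sref_comm_iff[OF w])
  then have vs: "v = sref_conj i w" using v(2) by blast
  have vi: "v \<in> invols n" unfolding vs by (rule sref_conj_invols[OF i w])
  have len: "cox_len n v = cox_len n w + 2" unfolding vs by (rule cox_len_sref_conj[OF w i up False])
  have "w i \<noteq> Suc i" using nc by (auto simp: sref_comm_iff[OF w])
  then have wt: "weight n v = weight n w * uu^2"
    unfolding weight_def len using card_exceedances_sref_conj[OF i w] by (simp add: vs power2_eq_square)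
  have "M_Ts_basis n i w v = 1"
    unfolding M_Ts_basis_up[OF w i up False] by (simp add: bas_def vs)
  moreover have "M_Ts_basis n i v w = uu^2"
    using M_Ts_basis_down[OF vi i] sref_conj_up_down[OF w up False] v(1) unfolding vs sref_conj_sref_conj
    by (simp add: lincomb_def bas_def)
  ultimately show ?thesis by (simp add: wt)
qed

text \<open>Off the diagonal, entries are nonzero only between partners, a symmetric relation, so
  the claim reduces to pairs oriented by an ascent.\<close>

lemma weight_M_Ts_basis:
  assumes w: "w \<in> invols n" and v: "v \<in> invols n" and i: "i \<in> {1..<n}"
  shows "weight n v * M_Ts_basis n i w v = weight n w * M_Ts_basis n i v w"
proof -
  let ?R = "\<lambda>v w. v = sref i \<circ> w \<and> sref i \<circ> w = w \<circ> sref i \<or> v = sref_conj i w \<and> sref i \<circ> w \<noteq> w \<circ> sref i"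
  have sym: "?R w v" if "?R v w" for v w
  proof -
    have "sref i \<circ> sref_conj i w = w \<circ> sref i" "sref_conj i w \<circ> sref i = sref i \<circ> w"
      by (simp_all add: sref_conj_def fun_eq_iff)
    moreover have "sref i \<circ> (sref i \<circ> w) = (sref i \<circ> w) \<circ> sref i" if "sref i \<circ> w = w \<circ> sref i"
      using that by (simp add: fun_eq_iff)
    ultimately show ?thesis using that by (metis sref_conj_sref_conj sref_comp_sref(2))
  qed
  have zero: "M_Ts_basis n i w v = 0" if "v \<noteq> w" "\<not> ?R v w" for v w
  proof -
    have nv: "bas w v = 0" using that by (simp add: bas_def)
    show ?thesis
    proof (cases "sref i \<circ> w = w \<circ> sref i")
      case True
      then have "bas (sref i \<circ> w) v = 0" using that by (auto simp: bas_def)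
      then show ?thesis unfolding M_Ts_basis_def Let_def if_P[OF True] by (simp add: nv)
    next
      case False
      then have "bas (sref i \<circ> w \<circ> sref i) v = 0" using that by (auto simp: bas_def sref_conj_def)
      then show ?thesis unfolding M_Ts_basis_def Let_def if_not_P[OF False] by (simp add: nv)
    qed
  qed
  show ?thesis
  proof (cases "v \<noteq> w \<and> ?R v w")
    case True
    \<comment> \<open>Passing to the partner turns a descent at \<open>i\<close> into an
      ascent.\<close>
    have asc: "w i < w (Suc i) \<or> v i < v (Suc i)"
    proof (cases rule: invols_cases[OF w, of i])
      case 2
      then have "v = sref i \<circ> w" using True sref_comm_iff[OF w, of i] by auto
      then show ?thesis using 2 by simp
    next
      case 4
      then have "v = sref_conj i w" using True sref_comm_iff[OF w, of i] by auto
      then show ?thesis using cox_len_sref_conj_down(2)[OF w i 4] by simp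
    qed auto
    then show ?thesis
    proof
      assume "w i < w (Suc i)"
      then show ?thesis using weight_M_Ts_basis_up[OF w i] True by blast
    next
      assume "v i < v (Suc i)"
      then show ?thesis using weight_M_Ts_basis_up[OF v i, of w] sym True by metis
    qed
  next
    case nR: False
    show ?thesis
    proof (cases "v = w")
      case False
      then have "\<not> ?R v w" using nR by blast
      moreover from this have "\<not> ?R w v" using sym[of w v] by blast
      ultimately show ?thesis using zero[of v w] zero[of w v] False by simp
    qed simp
  qed
qed

lemma form_M_Ts:
  assumes i: "i \<in> {1..<n}"
  shows "form n (M_Ts n i f) g = form n f (M_Ts n i g)"
proof -
  have "form n (M_Ts n i f) g = (\<Sum>v\<in>invols n. \<Sum>w\<in>invols n. f w * g v * (weight n v * M_Ts_basis n i w v))"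
    by (simp add: form_def M_Ts_def sum_distrib_left sum_distrib_right mult_ac)
  also have "\<dots> = (\<Sum>v\<in>invols n. \<Sum>w\<in>invols n. f w * g v * (weight n w * M_Ts_basis n i v w))"
    by (rule sum.cong[OF refl], rule sum.cong[OF refl], subst weight_M_Ts_basis[OF _ _ i]) auto
  also have "\<dots> = (\<Sum>w\<in>invols n. \<Sum>v\<in>invols n. f w * g v * (weight n w * M_Ts_basis n i v w))"
    by (rule sum.swap)
  also have "\<dots> = form n f (M_Ts n i g)"
    by (simp add: form_def M_Ts_def sum_distrib_left mult_ac)
  finally show ?thesis .
qed

lemma form_lincomb_left: "form n (lincomb a f b g) h = a * form n f h + b * form n g h"
  by (simp add: form_def lincomb_def sum_distrib_left sum.distrib algebra_simps)

lemma form_sum_left: "finite A \<Longrightarrow> form n (\<lambda>v. \<Sum>x\<in>A. c x * f x v) g = (\<Sum>x\<in>A. c x * form n (f x) g)"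
  unfolding form_def sum_distrib_left sum_distrib_right
  by (subst sum.swap) (simp add: mult_ac)

lemma form_sum_right: "finite A \<Longrightarrow> form n g (\<lambda>v. \<Sum>x\<in>A. c x * f x v) = (\<Sum>x\<in>A. c x * form n g (f x))"
  unfolding form_def sum_distrib_left
  by (subst sum.swap) (simp add: mult_ac)

lemma form_bas_left: "w \<in> invols n \<Longrightarrow> form n (bas w) g = weight n w * g w"
  by (simp add: form_def bas_def if_distrib[of "\<lambda>x. _ * x * _"] if_distrib[of "\<lambda>x. x * _"] cong: if_cong)

lemma form_bas_right: "w \<in> invols n \<Longrightarrow> form n f (bas w) = weight n w * f w"
  by (simp add: form_def bas_def if_distrib[of "\<lambda>x. _ * x"] cong: if_cong)

text \<open>The factor comes from the trace form of the Hecke algebra, for which T_w and u^(-2 l(w))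
  T_(w^-1) are dual bases.\<close>

definition eta :: "nat \<Rightarrow> vec \<Rightarrow> vec" where
  "eta n m = (\<lambda>w. if w \<in> perms n then inverse uu ^ (2 * cox_len n w) * form n (M_Tw n w (bas id)) m else 0)"

section \<open>Left multiplication on coefficients, and equivariance\<close>

lemma hecke_Ts_basis_coeff:
  assumes i: "i \<in> {1..<n}" and w: "w \<in> perms n" and v: "v \<in> perms n"
  shows "hecke_Ts_basis n i w v = (if w = v then if inv v i < inv v (Suc i) then 0 else uu^2 - 1 else 0)
    + (if w = sref i \<circ> v then if inv v i < inv v (Suc i) then uu^2 else 1 else 0)"
proof -
  have sv: "v = sref i \<circ> w \<longleftrightarrow> w = sref i \<circ> v" by (metis sref_comp_sref(2))
  have ne: "sref i \<circ> v \<noteq> v"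
  proof
    assume "sref i \<circ> v = v"
    then have "sref i (v (inv v i)) = v (inv v i)" by (metis comp_apply)
    then show False using perms_bij[OF v] by (simp add: bij_is_surj surj_f_inv_f)
  qed
  have lt: "inv (sref i \<circ> v) i < inv (sref i \<circ> v) (Suc i) \<longleftrightarrow> \<not> inv v i < inv v (Suc i)"
    using inv_eq_iff[OF v, of i "Suc i"] by (auto simp: inv_sref_comp[OF v])
  show ?thesis
    unfolding hecke_Ts_basis_def cox_len_sref_greater_iff[OF w i]
    using ne lt by (auto simp: bas_def sv)
qed

lemma hecke_Ts_apply:
  assumes i: "i \<in> {1..<n}" and v: "v \<in> perms n"
  shows "hecke_Ts n i h v = (if inv v i < inv v (Suc i) then uu^2 * h (sref i \<circ> v)
    else (uu^2 - 1) * h v + h (sref i \<circ> v))"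
proof -
  have sv: "sref i \<circ> v \<in> perms n" by (intro sref_comp_perms i v)
  show ?thesis
    using v sv unfolding hecke_Ts_def
    by (simp add: hecke_Ts_basis_coeff[OF i _ v] distrib_left sum.distrib if_distrib[of "\<lambda>x. _ * x"] cong: if_cong)
qed

lemma hecke_Ts_outside:
  assumes i: "i \<in> {1..<n}" and v: "v \<notin> perms n"
  shows "hecke_Ts n i h v = 0"
  unfolding hecke_Ts_def
proof (rule sum.neutral, rule ballI)
  fix w assume "w \<in> perms n"
  then have "v \<noteq> w" "v \<noteq> sref i \<circ> w" using v sref_comp_perms(1)[OF i] by auto
  then show "h w * hecke_Ts_basis n i w v = 0" by (simp add: hecke_Ts_basis_def bas_def)
qed

text \<open>Self-adjointness moves T_s onto T_v a_1, where the left multiplication rule applies. The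
  power of \<open>inverse uu\<close> turns that rule into its transpose, the action on
  coefficients.\<close>

lemma eta_M_Ts:
  assumes i: "i \<in> {1..<n}"
  shows "eta n (M_Ts n i m) = hecke_Ts n i (eta n m)"
proof
  fix v
  show "eta n (M_Ts n i m) v = hecke_Ts n i (eta n m) v"
  proof (cases "v \<in> perms n")
    case v: True
    have sv: "sref i \<circ> v \<in> perms n" by (intro sref_comp_perms i v)
    note b = bas_Mvec[OF id_invols]
    have eta: "eta n (M_Ts n i m) v = inverse uu ^ (2 * cox_len n v) * form n (M_Ts n i (M_Tw n v (bas id))) m"
      using v by (simp add: eta_def form_M_Ts[OF i])
    show ?thesis
    proof (cases "inv v i < inv v (Suc i)")
      case True
      then show ?thesis
        unfolding eta M_Ts_M_Tw_up[OF v i True b] hecke_Ts_apply[OF i v]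
        using sv cox_len_up[OF v i True] by (simp add: eta_def field_simps power2_eq_square)
    next
      case False
      then have d: "inv v (Suc i) < inv v i"
        using inv_eq_iff[OF v, of i "Suc i"] by simp
      then show ?thesis
        unfolding eta M_Ts_M_Tw_down[OF v i d b] hecke_Ts_apply[OF i v] form_lincomb_left
        using v sv cox_len_down[OF v i d] by (simp add: eta_def field_simps power2_eq_square)
    qed
  next
    case False
    then show ?thesis using hecke_Ts_outside[OF i] by (simp add: eta_def)
  qed
qed

lemma eta_M_Tw:
  assumes "w \<in> perms n"
  shows "eta n (M_Tw n w m) = hecke_Tw n w (eta n m)"
proof -
  have "eta n (act_word (M_Ts n) is m) = act_word (hecke_Ts n) is (eta n m)" if "simple_word n is" for "is"
    using that by (induction "is") (auto simp: eta_M_Ts)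
  then show ?thesis
    using is_reducedD(1)[OF reduced_word(1)[OF assms]] by (simp add: M_Tw_act_word hecke_Tw_def act_word_def)
qed

lemma eta_sum:
  "finite A \<Longrightarrow> eta n (\<lambda>v. \<Sum>x\<in>A. c x * f x v) = (\<lambda>v. \<Sum>x\<in>A. c x * eta n (f x) v)"
  by (rule ext) (simp add: eta_def form_sum_right sum_distrib_left mult_ac)

lemma eta_M_act: "eta n (M_act n h m) = hecke_mult n h (eta n m)"
  by (simp add: M_act_def hecke_mult_def eta_sum eta_M_Tw)

lemma eta_bas_id: "eta n (bas id) = X_empty n"
proof
  fix w
  have "inverse uu ^ (2 * k) * uu ^ k = inverse uu ^ k" for k
    by (simp add: mult_2 power_add power_inverse)
  then show "eta n (bas id) w = X_empty n w"
    by (simp add: eta_def X_empty_def form_bas_right weight_id M_Tw_unit_coeff)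
qed

section \<open>Cyclicity and bijectivity\<close>

lemma M_Ts_sum: "finite A \<Longrightarrow> M_Ts n i (\<lambda>v. \<Sum>x\<in>A. c x * f x v) = (\<lambda>v. \<Sum>x\<in>A. c x * M_Ts n i (f x) v)"
  unfolding M_Ts_def sum_distrib_left sum_distrib_right
  by (subst sum.swap) (simp add: mult_ac)

lemma M_act_bas: "w \<in> perms n \<Longrightarrow> M_act n (bas w) m = M_Tw n w m"
  by (rule ext) (simp add: M_act_def bas_def if_distrib[of "\<lambda>x. x * _"] cong: if_cong)

lemma M_act_Mvec: "m \<in> Mvec n \<Longrightarrow> M_act n h m \<in> Mvec n"
  unfolding M_act_def by (intro K_subspace_sum K_subspace_Mvec M_Tw_Mvec) auto

text \<open>Only the identity has no descent, so generation starts from a_1. The left multiplication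
  rules make the span of the T_w a_1 stable.\<close>

lemma Mvec_cyclic:
  assumes "m \<in> Mvec n"
  obtains h where "h \<in> Hvec n" "m = M_act n h (bas id)"
proof -
  let ?U = "{M_act n h (bas id) | h. h \<in> Hvec n}"
  have Tw: "M_Tw n w (bas id) \<in> ?U" if "w \<in> perms n" for w
    using that M_act_bas[OF that] by (auto simp: Hvec_def bas_def intro!: exI[of _ "bas w"])
  have U: "K_subspace ?U"
    unfolding K_subspace_def
  proof (intro conjI allI ballI)
    show "(\<lambda>v. 0) \<in> ?U"
      by (auto simp: M_act_def Hvec_def intro!: exI[of _ "\<lambda>v. 0"])
    fix a b f g assume "f \<in> ?U" "g \<in> ?U"
    then obtain h k where "h \<in> Hvec n" "k \<in> Hvec n" "f = M_act n h (bas id)" "g = M_act n k (bas id)"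
      by blast
    moreover have "M_act n (lincomb a h b k) (bas id) = lincomb a (M_act n h (bas id)) b (M_act n k (bas id))"
      by (simp add: M_act_def lincomb_def sum_distrib_left sum.distrib algebra_simps)
    ultimately show "lincomb a f b g \<in> ?U"
      by (auto simp: Hvec_def lincomb_def intro!: exI[of _ "lincomb a h b k"])
  qed
  have "Mvec n \<subseteq> ?U"
  proof (rule Mvec_subset_generated[OF U, where I = "{1..<n}"])
    fix i x assume i: "i \<in> {1..<n}" and "x \<in> ?U"
    then obtain h where x: "x = M_act n h (bas id)" by blast
    have "M_Ts n i (M_Tw n w (bas id)) \<in> ?U" if w: "w \<in> perms n" for w
    proof (cases "inv w i < inv w (Suc i)")
      case True
      then show ?thesis
        unfolding M_Ts_M_Tw_up[OF w i True bas_Mvec[OF id_invols]] by (intro Tw sref_comp_perms i w)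
    next
      case False
      then have "inv w (Suc i) < inv w i" using inv_eq_iff[OF w, of i "Suc i"] by simp
      from M_Ts_M_Tw_down[OF w i this bas_Mvec[OF id_invols]] show ?thesis
        by (simp only:) (intro K_subspace_lincomb U Tw sref_comp_perms i w)
    qed
    then show "M_Ts n i x \<in> ?U"
      unfolding x M_act_def[of n h] M_Ts_sum[OF finite_perms] by (intro K_subspace_sum U finite_perms)
  next
    fix w assume "w \<in> invols n" "\<And>i. i \<in> {1..<n} \<Longrightarrow> w i < w (Suc i)"
    then have "w = id" using perms_ascending_id invols_perms by blast
    then show "bas w \<in> ?U" using Tw[OF id_perms] by (simp add: M_Tw_id)
  qed simp
  then show thesis using assms that by blast
qed

text \<open>\<open>eta n m\<close> determines the form of \<open>m\<close> against every T_w a_1,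
  hence by cyclicity against each basis vector, which reads off a coefficient up to a nonzero
  weight.\<close>

lemma inj_on_eta: "inj_on (eta n) (Mvec n)"
proof (rule inj_onI)
  fix m m' assume m: "m \<in> Mvec n" "m' \<in> Mvec n" and eq: "eta n m = eta n m'"
  have Tw: "form n (M_Tw n w (bas id)) m = form n (M_Tw n w (bas id)) m'" if "w \<in> perms n" for w
    using fun_cong[OF eq, of w] that by (simp add: eta_def)
  show "m = m'"
  proof
    fix v
    show "m v = m' v"
    proof (cases "v \<in> invols n")
      case True
      obtain h where h: "bas v = M_act n h (bas id)" using Mvec_cyclic[OF bas_Mvec[OF True]] by blast
      have "form n (bas v) m = form n (bas v) m'"
        unfolding h M_act_def form_sum_left[OF finite_perms] by (simp add: Tw)
      then show ?thesis using True by (simp add: form_bas_left weight_nonzero)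
    next
      case False
      then show ?thesis using m by (simp add: Mvec_def)
    qed
  qed
qed

lemma eta_image: "eta n ` Mvec n = HX n"
proof
  show "eta n ` Mvec n \<subseteq> HX n"
  proof
    fix y assume "y \<in> eta n ` Mvec n"
    then obtain m where m: "m \<in> Mvec n" "y = eta n m" by blast
    from Mvec_cyclic[OF m(1)] obtain h where "h \<in> Hvec n" "m = M_act n h (bas id)" .
    then show "y \<in> HX n" using m eta_M_act[of n h "bas id"] by (auto simp: HX_def eta_bas_id)
  qed
  show "HX n \<subseteq> eta n ` Mvec n"
    using eta_M_act[of n _ "bas id"] M_act_Mvec[OF bas_Mvec[OF id_invols]]
    by (auto simp: HX_def eta_bas_id image_iff) metis
qed

theorem theorem5p3:
  fixes n :: nat
  assumes "n \<ge> 1"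
  shows "\<exists>\<eta>. is_Hiso n \<eta> \<and> \<eta> (bas id) = X_empty n \<and>
           (\<forall>\<eta>'. is_Hiso n \<eta>' \<and> \<eta>' (bas id) = X_empty n \<longrightarrow> (\<forall>m\<in>Mvec n. \<eta>' m = \<eta> m))"
proof (intro exI conjI allI impI ballI)
  show "is_Hiso n (eta n)"
    unfolding is_Hiso_def bij_betw_def
    by (simp add: inj_on_eta eta_image eta_M_act)
      (simp add: eta_def form_def fun_eq_iff distrib_left sum.distrib)
  show "eta n (bas id) = X_empty n" by (rule eta_bas_id)
  fix \<eta>' m assume \<eta>': "is_Hiso n \<eta>' \<and> \<eta>' (bas id) = X_empty n" and m: "m \<in> Mvec n"
  \<comment> \<open>Equivariance determines a map on a cyclic module by its value at the
    generator.\<close>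
  from Mvec_cyclic[OF m] obtain h where h: "h \<in> Hvec n" "m = M_act n h (bas id)" .
  then have "\<eta>' m = hecke_mult n h (X_empty n)"
    using \<eta>' bas_Mvec[OF id_invols] by (auto simp: is_Hiso_def)
  also have "\<dots> = eta n m" by (simp add: h eta_M_act eta_bas_id)
  finally show "\<eta>' m = eta n m" .
qed

end
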